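(* Let $\varphi$ be a minimal, uniquely ergodic homeomorphism of a Cantor space $X$. Then the set $\{g\in[\varphi]: g \text{ has finite order}\}$ is dense in $[\varphi]$ (for the topology induced by $\mathrm{Homeo}(X)$).
   Context: $[\varphi]=\{g\in\mathrm{Homeo}(X):\forall x\ \exists n\in\mathbb Z\ g(x)=\varphi^n(x)\}$. $\mathrm{Homeo}(X)$ carries the topology with basic open sets $\{g: g(U_i)=V_i,\ i\le n\}$ for clopen $U_i,V_i$. Uniquely ergodic means there is exactly one $\varphi$-invariant Borel probability measure. *)

theory Defs
  imports "HOL-Probability.Probability"
begin

definition cantor_space :: "'a topology \<Rightarrow> bool" where
  "cantor_space X \<longleftrightarrow>
     topspace X \<noteq> {} \<and> compact_space X \<and> metrizable_space X \<and> X dim_le 0 \<and>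
     X derived_set_of topspace X = topspace X"

definition Homeo :: "('a::topological_space \<Rightarrow> 'a) set" where
  "Homeo = {g. homeomorphic_map euclidean euclidean g}"

definition clopen :: "'a::topological_space set \<Rightarrow> bool" where
  "clopen U \<longleftrightarrow> open U \<and> closed U"

text \<open>The sets below form a subbase; their finite intersections are the basic open sets
  \<open>{g. g(U\<^sub>i) = V\<^sub>i for all i \<le> n}\<close>.\<close>

definition Homeo_topology :: "('a::topological_space \<Rightarrow> 'a) topology" where
  "Homeo_topology =
     topology_generated_by {{g \<in> Homeo. g ` U = V} | U V. clopen U \<and> clopen V}"

text \<open>Meaningful only for bijective \<open>f\<close>.\<close>

definition int_iterate :: "('a \<Rightarrow> 'a) \<Rightarrow> int \<Rightarrow> 'a \<Rightarrow> 'a" where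
  "int_iterate f n = (if 0 \<le> n then f ^^ nat n else inv f ^^ nat (- n))"

definition full_group :: "('a::topological_space \<Rightarrow> 'a) \<Rightarrow> ('a \<Rightarrow> 'a) set" where
  "full_group \<phi> = {g \<in> Homeo. \<forall>x. \<exists>n. g x = int_iterate \<phi> n x}"

definition minimal_homeo :: "('a::topological_space \<Rightarrow> 'a) \<Rightarrow> bool" where
  "minimal_homeo \<phi> \<longleftrightarrow>
     \<phi> \<in> Homeo \<and> (\<forall>x. closure (range (\<lambda>n. int_iterate \<phi> n x)) = UNIV)"

definition invariant_prob :: "('a::topological_space \<Rightarrow> 'a) \<Rightarrow> 'a measure \<Rightarrow> bool" where
  "invariant_prob \<phi> \<mu> \<longleftrightarrow>
     prob_space \<mu> \<and> sets \<mu> = sets borel \<and>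
     (\<forall>A \<in> sets borel. emeasure \<mu> (\<phi> -` A) = emeasure \<mu> A)"

definition uniquely_ergodic :: "('a::topological_space \<Rightarrow> 'a) \<Rightarrow> bool" where
  "uniquely_ergodic \<phi> \<longleftrightarrow> (\<exists>!\<mu>. invariant_prob \<phi> \<mu>)"

definition finite_order :: "('a \<Rightarrow> 'a) \<Rightarrow> bool" where
  "finite_order g \<longleftrightarrow> (\<exists>n>0. g ^^ n = id)"

end

(*
  A homeomorphism g in [phi] carries the atoms A_i of a finite clopen partition to clopen sets B_i of
  the same measure, and a finite-order h with h(A_i) = B_i is as close to g as the partition is fine.
  Unique ergodicity makes the Birkhoff sums of 1_B - 1_A uniformly positive whenever
  mu(A) < mu(B) (otherwise a limit of empirical measures would be a second invariant measure), and
  matching points of A with points of B along orbits like opening and closing parentheses gives an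
  involution in [phi] moving A into B.  If mu(A) = mu(B), exhausting A and B by such
  partial matchings down to a pair of points of a single orbit gives an involution exchanging A
  and B (Glasner-Weiss).  Finally h is found by induction on the number of atoms: with p an
  involution exchanging A_n - B_n and B_n - A_n, solve the problem for the pairs (A_i, p(B_i)), i < n, by h'
  and put h = p o h'; each orbit of h is an orbit of h' with at most as many points inserted.
*)

theory Submission
  imports Defs
begin

section \<open>Clopen sets in Cantor spaces\<close>

text \<open>Two obstacles shape the argument. For equal measures there is no uniform positivity of
  Birkhoff sums, so nothing bounds how long a parenthesis stays open. Each partial matching
  therefore leaves a small remainder on both sides. The remainders shrink to a point of
  \<open>A\<close> and a point of \<open>B\<close>, which the limit map has to swap; membership in
  the full group then demands that the two points share an orbit, and minimality provides such a
  pair at the start. Exponents of \<open>\<phi>\<close> may be unbounded near these points, which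
  \<open>full_group\<close> allows because its condition is pointwise. Second, a product of elements
  of finite order can have infinite order. The induction therefore also demands that
  \<open>h'\<close> is the identity off the union of its atoms, in particular on \<open>A_n\<close>;
  this limits how often \<open>p\<close> can interfere between two steps of \<open>h'\<close>.
  Equality of the measures of \<open>A_i\<close> and \<open>B_i\<close> comes from the fact that
  every element of the full group preserves \<open>\<mu>\<close>, being a power of
  \<open>\<phi>\<close> on each of countably many Borel pieces.\<close>

lemma clopen_Int: "clopen U \<Longrightarrow> clopen V \<Longrightarrow> clopen (U \<inter> V)"
  and clopen_Un: "clopen U \<Longrightarrow> clopen V \<Longrightarrow> clopen (U \<union> V)"
  and clopen_Diff: "clopen U \<Longrightarrow> clopen V \<Longrightarrow> clopen (U - V)"
  and clopen_Compl: "clopen U \<Longrightarrow> clopen (- U)"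
  and clopen_UNIV: "clopen UNIV"
  and clopen_empty: "clopen {}"
  by (auto simp: clopen_def open_Diff closed_Diff)

lemma clopen_UN: "finite I \<Longrightarrow> (\<And>i. i \<in> I \<Longrightarrow> clopen (U i)) \<Longrightarrow> clopen (\<Union>i\<in>I. U i)"
  by (auto simp: clopen_def)

lemma clopen_INT: "finite I \<Longrightarrow> (\<And>i. i \<in> I \<Longrightarrow> clopen (U i)) \<Longrightarrow> clopen (\<Inter>i\<in>I. U i)"
  by (auto simp: clopen_def)

lemma clopen_borel: "clopen U \<Longrightarrow> U \<in> sets borel"
  by (auto simp: clopen_def)

locale cantor =
  fixes ty :: "'a::topological_space itself"
  assumes cantor: "cantor_space (euclidean :: 'a topology)"
begin

lemma compact_UNIV: "compact (UNIV :: 'a set)"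
  using cantor by (simp add: cantor_space_def compact_space_def)

lemma Hausdorff: "Hausdorff_space (euclidean :: 'a topology)"
  using cantor by (simp add: cantor_space_def metrizable_imp_Hausdorff_space)

text \<open>Dimension at most 0 gives neighbourhoods whose frontier has dimension at most -1, that
  is, is empty; an open set with empty frontier is closed.\<close>

lemma clopen_nbhd:
  assumes "open V" "(x::'a) \<in> V"
  obtains U where "clopen U" "x \<in> U" "U \<subseteq> V"
proof -
  have "(euclidean :: 'a topology) dim_le 0"
    using cantor by (simp add: cantor_space_def)
  then have "\<exists>U. x \<in> U \<and> U \<subseteq> V \<and> openin euclidean U \<and> subtopology euclidean (euclidean frontier_of U) dim_le (0 - 1)"
    using assms by (cases rule: dimension_le.cases) auto
  then obtain U where U: "x \<in> U" "U \<subseteq> V" "open U"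
      "subtopology euclidean (euclidean frontier_of U) dim_le (-1)"
    by auto
  then have "euclidean frontier_of U = {}"
    unfolding dimension_le_eq_empty by (metis inf_top_left null_topspace_iff_trivial topspace_euclidean topspace_subtopology)
  then have "closed U"
    using U(3) frontier_of_eq_empty[of U euclidean] by simp
  then show ?thesis
    using U that by (auto simp: clopen_def)
qed

text \<open>By compactness, finitely many clopen sets inside balls of radius \<open>1/(n+1)\<close>
  cover the space; these covers together, over all \<open>n\<close>, form the base.\<close>

lemma countable_clopen_base:
  obtains b :: "nat \<Rightarrow> 'a set" where "\<And>n. clopen (b n)"
    "\<And>V x. open V \<Longrightarrow> x \<in> V \<Longrightarrow> \<exists>n. x \<in> b n \<and> b n \<subseteq> V"
proof -
  obtain d where M: "Metric_space UNIV d" and e: "(euclidean :: 'a topology) = Metric_space.mtopology UNIV d"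
    using cantor unfolding cantor_space_def metrizable_space_def
    by (metis Metric_space.topspace_mtopology topspace_euclidean)
  interpret Metric_space "UNIV :: 'a set" d by fact
  have ob: "open (mball x r)" for x :: 'a and r
    using openin_mball[of x r] unfolding e[symmetric] by simp
  have "\<exists>F. finite F \<and> (\<forall>U\<in>F. clopen U \<and> (\<exists>c. U \<subseteq> mball c (inverse (Suc n)))) \<and> (UNIV :: 'a set) \<subseteq> \<Union>F" for n
  proof -
    let ?C = "{U. clopen U \<and> (\<exists>c. U \<subseteq> mball c (inverse (Suc n)))}"
    have "UNIV \<subseteq> \<Union>?C"
    proof
      fix x :: 'a
      have "x \<in> mball x (inverse (Suc n))" by simp
      then obtain U where "clopen U" "x \<in> U" "U \<subseteq> mball x (inverse (Suc n))"
        using clopen_nbhd[OF ob] by blast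
      then show "x \<in> \<Union>?C" by blast
    qed
    then obtain F where "F \<subseteq> ?C" "finite F" "UNIV \<subseteq> \<Union>F"
      by (rule compactE[OF compact_UNIV]) (auto simp: clopen_def)
    then show ?thesis by (intro exI[of _ F] conjI ballI) blast+
  qed
  then obtain F where F: "\<And>n. finite (F n)" "\<And>n U. U \<in> F n \<Longrightarrow> clopen U"
      "\<And>n U. U \<in> F n \<Longrightarrow> \<exists>c. U \<subseteq> mball c (inverse (Suc n))" "\<And>n. (UNIV :: 'a set) \<subseteq> \<Union>(F n)"
    by metis
  define B where "B = (\<Union>n. F n)"
  have "countable B" using F(1) by (auto simp: B_def countable_finite)
  have "F 0 \<noteq> {}" using F(4)[of 0] by auto
  then have "B \<noteq> {}" by (auto simp: B_def)
  then have r: "range (from_nat_into B) = B"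
    using \<open>countable B\<close> by (rule range_from_nat_into)
  show ?thesis
  proof (rule that[of "from_nat_into B"])
    show "clopen (from_nat_into B n)" for n
      using from_nat_into[OF \<open>B \<noteq> {}\<close>, of n] F(2) by (auto simp: B_def)
    fix V and x :: 'a assume V: "open V" "x \<in> V"
    then obtain r where r0: "r > 0" "mball x r \<subseteq> V"
      using openin_mtopology[of V] unfolding e[symmetric] by auto
    \<comment> \<open>Half of \<open>r\<close>, because the ball around a covering set is centred at
      some \<open>c\<close> and not at \<open>x\<close>.\<close>
    obtain n where n: "inverse (Suc n) < r / 2"
      using reals_Archimedean[of "r/2"] r0 by auto
    obtain U where U: "U \<in> F n" "x \<in> U" using F(4)[of n] by blast
    obtain c where c: "U \<subseteq> mball c (inverse (Suc n))" using F(3)[OF U(1)] by blast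
    have "U \<subseteq> mball x r"
    proof
      fix y assume "y \<in> U"
      then have "d c y < r/2" "d c x < r/2" using c U n by auto
      then show "y \<in> mball x r" using triangle[of x c y] commute[of x c] by simp
    qed
    then have "x \<in> U \<and> U \<subseteq> V" "U \<in> B" using U r0 by (auto simp: B_def)
    then show "\<exists>n. x \<in> from_nat_into B n \<and> from_nat_into B n \<subseteq> V"
      using r by (metis imageE)
  qed
qed

lemma clopen_nbhd_seq:
  obtains W :: "nat \<Rightarrow> 'a set" where "\<And>n. clopen (W n)" "\<And>n. x \<in> W n" "decseq W"
    "\<And>V. open V \<Longrightarrow> x \<in> V \<Longrightarrow> \<exists>n. W n \<subseteq> V"
proof -
  obtain b :: "nat \<Rightarrow> 'a set" where b: "\<And>n. clopen (b n)"
    "\<And>V x. open V \<Longrightarrow> x \<in> V \<Longrightarrow> \<exists>n. x \<in> b n \<and> b n \<subseteq> V"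
    by (rule countable_clopen_base) blast
  define W where "W n = (\<Inter>i\<in>{i. i \<le> n \<and> x \<in> b i}. b i)" for n
  show ?thesis
  proof (rule that[of W])
    show "clopen (W n)" for n unfolding W_def by (rule clopen_INT) (auto simp: b)
    show "x \<in> W n" for n by (auto simp: W_def)
    show "decseq W" by (auto simp: decseq_def W_def)
    show "\<exists>n. W n \<subseteq> V" if "open V" "x \<in> V" for V
      using b(2)[OF that] by (force simp: W_def)
  qed
qed

text \<open>With a countable clopen base every open set is a countable union of clopen sets.
  Measures can thus be built and compared on clopen sets alone.\<close>

lemma sigma_sets_clopen: "sigma_sets UNIV {U :: 'a set. clopen U} = sets borel"
proof -
  obtain b :: "nat \<Rightarrow> 'a set" where b: "\<And>n. clopen (b n)"
    "\<And>V x. open V \<Longrightarrow> x \<in> V \<Longrightarrow> \<exists>n. x \<in> b n \<and> b n \<subseteq> V"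
    by (rule countable_clopen_base) blast
  interpret S: sigma_algebra UNIV "sigma_sets UNIV {U :: 'a set. clopen U}"
    by (rule sigma_algebra_sigma_sets) auto
  have "V \<in> sigma_sets UNIV {U :: 'a set. clopen U}" if "open V" for V
  proof -
    have "V = (\<Union>i\<in>{i. b i \<subseteq> V}. b i)"
      using b(2)[OF that] by blast
    also have "\<dots> \<in> sigma_sets UNIV {U :: 'a set. clopen U}"
      using b(1) by (intro S.countable_UN'') auto
    finally show ?thesis .
  qed
  then have "sigma_sets UNIV {S::'a set. open S} \<subseteq> sigma_sets UNIV {U :: 'a set. clopen U}"
    by (intro sigma_sets_subseteq S.sigma_sets_subset) auto
  moreover have "sigma_sets UNIV {U :: 'a set. clopen U} \<subseteq> sigma_sets UNIV {S::'a set. open S}"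
    by (intro sigma_sets_subseteq) (auto simp: clopen_def)
  ultimately show ?thesis
    by (simp add: sets_borel)
qed

text \<open>The form of compactness that turns finite additivity on clopen sets into countable
  additivity: continuity at the empty set becomes trivial.\<close>

lemma decseq_clopen_empty:
  assumes "\<And>n. clopen (A n :: 'a set)" "decseq A" "(\<Inter>n. A n) = {}"
  shows "\<exists>n. A n = {}"
proof (rule ccontr)
  assume ne: "\<nexists>n. A n = {}"
  have "UNIV \<inter> (\<Inter>n\<in>UNIV. A n) \<noteq> {}"
  proof (rule compact_imp_fip_image[OF compact_UNIV])
    show "closed (A n)" for n using assms(1) by (auto simp: clopen_def)
    fix I :: "nat set" assume I: "finite I"
    have "A (Max (insert 0 I)) \<subseteq> (\<Inter>i\<in>I. A i)"
      using I by (intro INT_greatest decseqD[OF assms(2)]) auto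
    then show "UNIV \<inter> (\<Inter>i\<in>I. A i) \<noteq> {}" using ne by fastforce
  qed
  then show False using assms(3) by simp
qed

text \<open>A continuous bijection from a compact space to a Hausdorff space has a continuous
  inverse, so later constructions check continuity in one direction only.\<close>

lemma HomeoI:
  fixes h :: "'a \<Rightarrow> 'a"
  assumes "bij h" "continuous_on UNIV h"
  shows "h \<in> Homeo"
  unfolding Homeo_def using assms cantor Hausdorff
  by (auto intro!: continuous_imp_homeomorphic_map simp: cantor_space_def bij_def)

lemma closed_Collect_eq:
  fixes f g :: "'a \<Rightarrow> 'a"
  assumes "continuous_on UNIV f" "continuous_on UNIV g"
  shows "closed {x. f x = g x}"
  using closedin_continuous_maps_eq[OF Hausdorff, of euclidean f g] assms by simp

end

lemma Homeo_iff: "h \<in> Homeo \<longleftrightarrow> bij h \<and> continuous_on UNIV h \<and> continuous_on UNIV (inv h)"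
proof
  assume "h \<in> Homeo"
  then obtain g where "homeomorphic_maps euclidean euclidean h g"
    by (auto simp: Homeo_def homeomorphic_map_maps)
  then have *: "continuous_on UNIV h" "continuous_on UNIV g" "\<And>x. g (h x) = x" "\<And>x. h (g x) = x"
    by (auto simp: homeomorphic_maps_def)
  then have "bij h" by (metis bijI')
  moreover have "inv h = g" using * by (metis inv_equality)
  ultimately show "bij h \<and> continuous_on UNIV h \<and> continuous_on UNIV (inv h)" using * by simp
next
  assume *: "bij h \<and> continuous_on UNIV h \<and> continuous_on UNIV (inv h)"
  then have "homeomorphic_maps euclidean euclidean h (inv h)"
    by (auto simp: homeomorphic_maps_def bij_is_inj surj_f_inv_f bij_is_surj)
  then show "h \<in> Homeo" by (auto simp: Homeo_def homeomorphic_map_maps)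
qed

lemma Homeo_inv: "h \<in> Homeo \<Longrightarrow> inv h \<in> Homeo"
  by (auto simp: Homeo_iff bij_imp_bij_inv inv_inv_eq)

lemma Homeo_comp: "g \<in> Homeo \<Longrightarrow> h \<in> Homeo \<Longrightarrow> g \<circ> h \<in> Homeo"
  unfolding Homeo_def using homeomorphic_map_compose by blast

lemma Homeo_id: "id \<in> Homeo"
  by (auto simp: Homeo_iff)

lemma Homeo_image: "h \<in> Homeo \<Longrightarrow> h ` A = inv h -` A"
  by (simp add: Homeo_iff bij_vimage_eq_inv_image bij_imp_bij_inv inv_inv_eq)

lemma Homeo_clopen_vimage: "h \<in> Homeo \<Longrightarrow> clopen U \<Longrightarrow> clopen (h -` U)"
  by (auto simp: Homeo_iff clopen_def intro: open_vimage closed_vimage)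

lemma Homeo_clopen_image: "h \<in> Homeo \<Longrightarrow> clopen U \<Longrightarrow> clopen (h ` U)"
  by (simp add: Homeo_image Homeo_clopen_vimage Homeo_inv)

section \<open>The full group\<close>

lemma int_iterate_0: "int_iterate f 0 = id"
  by (simp add: int_iterate_def)

lemma int_iterate_of_nat: "int_iterate f (int n) = f ^^ n"
  by (simp add: int_iterate_def)

lemma int_iterate_Suc:
  assumes "bij f"
  shows "int_iterate f (n + 1) = f \<circ> int_iterate f n"
proof (cases "0 \<le> n")
  case True
  then show ?thesis by (simp add: int_iterate_def nat_add_distrib)
next
  case False
  then obtain k where "n = - int k" "k > 0"
    by (metis not_le zero_less_imp_eq_int neg_0_less_iff_less minus_minus)
  then obtain j where n: "n = - int (Suc j)" by (metis gr0_implies_Suc)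
  have "f \<circ> inv f = id" using assms by (simp add: bij_is_surj flip: surj_iff)
  then show ?thesis by (simp add: int_iterate_def n o_assoc nat_add_distrib)
qed

lemma int_iterate_pred:
  assumes "bij f"
  shows "int_iterate f (n - 1) = inv f \<circ> int_iterate f n"
  using int_iterate_Suc[OF assms, of "n - 1"] inv_o_cancel[OF bij_is_inj[OF assms]]
  by (simp add: o_assoc)

lemma int_iterate_add:
  assumes "bij f"
  shows "int_iterate f (m + n) = int_iterate f m \<circ> int_iterate f n"
proof (induction m rule: int_induct[of _ 0])
  case base
  then show ?case by (simp add: int_iterate_0)
next
  case (step1 i)
  then show ?case
    using int_iterate_Suc[OF assms, of "i + n"] int_iterate_Suc[OF assms, of i]
    by (simp add: ac_simps o_assoc)
next
  case (step2 i)
  then show ?case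
    using int_iterate_pred[OF assms, of "i + n"] int_iterate_pred[OF assms, of i]
    by (simp add: algebra_simps o_assoc)
qed

lemma int_iterate_minus:
  assumes "bij f"
  shows "int_iterate f (- n) (int_iterate f n x) = x"
  using int_iterate_add[OF assms, of "-n" n] by (simp add: int_iterate_0 fun_eq_iff)

lemma Homeo_funpow: "f \<in> Homeo \<Longrightarrow> f ^^ n \<in> Homeo"
  by (induction n) (auto intro: Homeo_comp simp: Homeo_id[unfolded id_def] id_def)

lemma Homeo_int_iterate: "f \<in> Homeo \<Longrightarrow> int_iterate f n \<in> Homeo"
  by (simp add: int_iterate_def Homeo_funpow Homeo_inv)

locale cantor_minimal = cantor ty for ty :: "'a::topological_space itself" +
  fixes \<phi> :: "'a \<Rightarrow> 'a"
  assumes minimal: "minimal_homeo \<phi>"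
begin

lemma Homeo_phi: "\<phi> \<in> Homeo"
  using minimal by (simp add: minimal_homeo_def)

lemma bij_phi: "bij \<phi>"
  using Homeo_phi by (simp add: Homeo_iff)

lemma int_iterate_in_full_group: "int_iterate \<phi> n \<in> full_group \<phi>"
  using Homeo_int_iterate[OF Homeo_phi] by (auto simp: full_group_def)

lemma full_group_id: "id \<in> full_group \<phi>"
  using int_iterate_in_full_group[of 0] by (simp add: int_iterate_0)

lemma full_group_comp:
  assumes "g \<in> full_group \<phi>" "h \<in> full_group \<phi>"
  shows "g \<circ> h \<in> full_group \<phi>"
proof -
  have "\<exists>n. g (h x) = int_iterate \<phi> n x" for x
  proof -
    obtain n where "h x = int_iterate \<phi> n x" using assms by (auto simp: full_group_def)
    moreover obtain m where "g (h x) = int_iterate \<phi> m (h x)" using assms by (auto simp: full_group_def)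
    ultimately show ?thesis
      by (intro exI[of _ "m + n"]) (simp add: int_iterate_add[OF bij_phi])
  qed
  then show ?thesis using assms by (auto simp: full_group_def intro: Homeo_comp)
qed

lemma full_group_bij: "g \<in> full_group \<phi> \<Longrightarrow> bij g"
  by (simp add: full_group_def Homeo_iff)

lemma full_group_clopen_image: "g \<in> full_group \<phi> \<Longrightarrow> clopen U \<Longrightarrow> clopen (g ` U)"
  by (simp add: full_group_def Homeo_clopen_image)

text \<open>Agreement with full group elements is asked only pointwise, with no local constancy of
  exponents; this admits the map of \<open>exchange_disjoint\<close> at its two limit
  points.\<close>

lemma full_groupI:
  assumes "bij h" "continuous_on UNIV h" "\<And>x. \<exists>g\<in>full_group \<phi>. h x = g x"
  shows "h \<in> full_group \<phi>"
proof -
  have "\<exists>n. h x = int_iterate \<phi> n x" for x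
    using assms(3)[of x] by (auto simp: full_group_def)
  then show ?thesis using HomeoI[OF assms(1,2)] by (simp add: full_group_def)
qed

lemma continuous_at_glue:
  assumes "open U" "x \<in> U" "g \<in> full_group \<phi>" "\<And>y. y \<in> U \<Longrightarrow> h y = g y"
  shows "(h \<longlongrightarrow> h x) (at x)"
proof -
  have "(g \<longlongrightarrow> g x) (at x)"
    using assms(3) by (auto simp: full_group_def Homeo_iff continuous_on_def)
  moreover have "eventually (\<lambda>y. y \<in> U) (at x)"
    using assms(1,2) by (rule eventually_at_in_open')
  ultimately show ?thesis
    using assms by (auto elim!: Lim_transform_eventually elim: eventually_mono)
qed

lemma full_group_glue:
  assumes "bij h" "\<And>x. \<exists>U g. open U \<and> x \<in> U \<and> g \<in> full_group \<phi> \<and> (\<forall>y\<in>U. h y = g y)"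
  shows "h \<in> full_group \<phi>"
proof (rule full_groupI)
  show "continuous_on UNIV h"
    unfolding continuous_on_def using assms(2) continuous_at_glue by (metis)
  show "\<exists>g\<in>full_group \<phi>. h x = g x" for x
    using assms(2)[of x] by blast
qed fact

lemma orbit_meets:
  assumes "open U" "U \<noteq> {}"
  shows "\<exists>n. int_iterate \<phi> n x \<in> U"
proof -
  have "closure (range (\<lambda>n. int_iterate \<phi> n x)) = UNIV"
    using minimal by (simp add: minimal_homeo_def)
  then have "U \<inter> range (\<lambda>n. int_iterate \<phi> n x) \<noteq> {}"
    using assms open_Int_closure_eq_empty by blast
  then show ?thesis by blast
qed

lemma finite_closed: "finite (F :: 'a set) \<Longrightarrow> closed F"
  using Hausdorff closedin_Hausdorff_finite[of euclidean F] by simp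

text \<open>A finite orbit is closed, hence by minimality the whole space, and a finite Hausdorff
  space has no accumulation points.\<close>

lemma infinite_orbit: "infinite (range (\<lambda>n. int_iterate \<phi> n x))"
proof
  assume fin: "finite (range (\<lambda>n. int_iterate \<phi> n x))"
  then have "range (\<lambda>n. int_iterate \<phi> n x) = UNIV"
    using minimal closure_closed[OF finite_closed[OF fin]] by (metis minimal_homeo_def)
  then have "finite (UNIV :: 'a set)" using fin by simp
  then have "euclidean derived_set_of (UNIV :: 'a set) = {}"
    by (rule derived_set_of_finite[OF Hausdorff])
  then show False
    using cantor by (simp add: cantor_space_def)
qed

end

section \<open>Uniform positivity of Birkhoff sums\<close>

lemma (in cantor) clopen_content_extends:
  fixes m :: "'a set \<Rightarrow> real"
  assumes nonneg: "\<And>U. clopen U \<Longrightarrow> 0 \<le> m U"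
    and add: "\<And>U V. clopen U \<Longrightarrow> clopen V \<Longrightarrow> U \<inter> V = {} \<Longrightarrow> m (U \<union> V) = m U + m V"
  obtains \<nu> where "sets \<nu> = sets borel" "\<And>U. clopen U \<Longrightarrow> emeasure \<nu> U = ennreal (m U)"
proof -
  let ?C = "{U :: 'a set. clopen U}"
  have m0: "m {} = 0" using add[of "{}" "{}"] by (simp add: clopen_empty)
  interpret ring_of_sets UNIV ?C
    by (rule ring_of_setsI) (auto simp: clopen_empty clopen_Un clopen_Diff)
  have "\<exists>\<mu> :: 'a set \<Rightarrow> ennreal. (\<forall>s \<in> ?C. \<mu> s = ennreal (m s)) \<and> measure_space UNIV (sigma_sets UNIV ?C) \<mu>"
  proof (rule caratheodory_empty_continuous)
    show "positive ?C (\<lambda>U. ennreal (m U))" by (simp add: positive_def m0)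
    show "additive ?C (\<lambda>U. ennreal (m U))"
      by (simp add: additive_def add nonneg ennreal_plus)
    fix A :: "nat \<Rightarrow> 'a set" assume A: "range A \<subseteq> ?C" "decseq A" "(\<Inter>i. A i) = {}"
    then obtain n where "A n = {}" using decseq_clopen_empty[of A] by auto
    then have "A k = {}" if "k \<ge> n" for k using decseqD[OF A(2) that] by simp
    then have "eventually (\<lambda>k. ennreal (m (A k)) = 0) sequentially"
      by (auto simp: eventually_sequentially m0 intro!: exI[of _ n])
    then show "(\<lambda>i. ennreal (m (A i))) \<longlonglongrightarrow> 0" by (rule tendsto_eventually)
  qed simp
  then obtain \<mu> where \<mu>: "\<And>U. clopen U \<Longrightarrow> \<mu> U = ennreal (m U)" "measure_space UNIV (sets borel) \<mu>"
    by (auto simp: sigma_sets_clopen)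
  define \<nu> where "\<nu> = measure_of UNIV (sets borel) \<mu>"
  have "sets \<nu> = sets borel"
    unfolding \<nu>_def using sets.sigma_sets_eq[of "borel :: 'a measure"] by (subst sets_measure_of) auto
  moreover have "emeasure \<nu> U = ennreal (m U)" if "clopen U" for U
    using \<mu> that clopen_borel[OF that] unfolding \<nu>_def
    by (subst emeasure_measure_of_sigma) (auto simp: measure_space_def)
  ultimately show ?thesis by (rule that)
qed

lemma (in cantor) measure_eqI_clopen:
  fixes \<mu> \<nu> :: "'a measure"
  assumes "sets \<mu> = sets borel" "sets \<nu> = sets borel" "emeasure \<mu> UNIV \<noteq> \<infinity>"
    and "\<And>U. clopen U \<Longrightarrow> emeasure \<mu> U = emeasure \<nu> U"
  shows "\<mu> = \<nu>"
  by (rule measure_eqI_generator_eq[where E = "{U. clopen U}" and \<Omega> = UNIV and A = "\<lambda>_. UNIV"])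
     (use assms in \<open>auto simp: sigma_sets_clopen Int_stable_def clopen_Int clopen_UNIV\<close>)

text \<open>By Tychonoff the functions into \<open>{0..1}\<close> form a compact space, so the
  sequence has a cluster point. For an uncountable index type no subsequence need converge
  pointwise; the filter \<open>G\<close> takes its place.\<close>

lemma cluster_content:
  fixes a :: "nat \<Rightarrow> 'b \<Rightarrow> real"
  assumes "\<And>n U. a n U \<in> {0..1}"
  obtains G m where "G \<noteq> bot" "G \<le> sequentially" "\<And>U. ((\<lambda>n. a n U) \<longlongrightarrow> m U) G"
proof -
  let ?K = "PiE UNIV (\<lambda>_. {0..1}) :: ('b \<Rightarrow> real) set"
  have "compactin (product_topology (\<lambda>_. euclidean) UNIV) ?K"
    by (simp add: compactin_PiE)
  then have "compact ?K" by (simp add: euclidean_product_topology)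
  moreover have "filtermap a sequentially \<noteq> bot"
    by (simp add: filtermap_bot_iff)
  moreover have "eventually (\<lambda>f. f \<in> ?K) (filtermap a sequentially)"
    using assms by (simp add: eventually_filtermap PiE_UNIV_domain)
  ultimately obtain m where m: "inf (nhds m) (filtermap a sequentially) \<noteq> bot"
    unfolding compact_filter by blast
  \<comment> \<open>Convergence along \<open>G\<close> holds by construction; only
    \<open>G \<noteq> bot\<close> uses that \<open>m\<close> is a cluster point.\<close>
  define G where "G = inf (filtercomap a (nhds m)) sequentially"
  have "G \<noteq> bot"
  proof
    assume "G = bot"
    then have "eventually (\<lambda>_. False) G" by simp
    then obtain P Q where PQ: "eventually P (filtercomap a (nhds m))" "eventually Q sequentially"
        "\<And>x. P x \<Longrightarrow> Q x \<Longrightarrow> False"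
      by (auto simp: G_def eventually_inf)
    obtain P' where P': "eventually P' (nhds m)" "\<And>n. P' (a n) \<Longrightarrow> P n"
      using PQ(1) by (auto simp: eventually_filtercomap)
    have "eventually (\<lambda>f. \<not> P' f) (filtermap a sequentially)"
      using PQ(2) unfolding eventually_filtermap by eventually_elim (use PQ P' in auto)
    with P'(1) have "eventually (\<lambda>_. False) (inf (nhds m) (filtermap a sequentially))"
      unfolding eventually_inf by blast
    then show False using m by (simp add: eventually_False)
  qed
  moreover have "G \<le> sequentially" by (simp add: G_def)
  moreover have "((\<lambda>n. a n U) \<longlongrightarrow> m U) G" for U
  proof -
    have "filterlim a (nhds m) G"
      by (rule filterlim_mono[OF filterlim_filtercomap order.refl]) (simp add: G_def)
    then have "eventually (\<lambda>n. a n U \<in> S) G" if "open S" "m U \<in> S" for S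
      using that open_vimage[OF \<open>open S\<close> continuous_on_product_coordinates[of U]]
      by (auto dest: topological_tendstoD[where S = "(\<lambda>f. f U) -` S"])
    then show ?thesis by (rule topological_tendstoI)
  qed
  ultimately show ?thesis by (rule that)
qed

text \<open>\<open>\<nu>\<close> is a limit of the empirical measures of the orbit segments of
  length \<open>n + 1\<close> from \<open>x n\<close>. Letting the starting point vary with
  \<open>n\<close> is what makes \<open>positive_sums\<close> uniform in the point.\<close>

lemma (in cantor) invariant_measure_limit:
  fixes \<phi> :: "'a \<Rightarrow> 'a" and x :: "nat \<Rightarrow> 'a"
  assumes "\<phi> \<in> Homeo"
  obtains \<nu> where "invariant_prob \<phi> \<nu>"
    "\<And>A B. clopen A \<Longrightarrow> clopen B \<Longrightarrow>
      (\<And>n. (\<Sum>i<Suc n. indicator B ((\<phi> ^^ i) (x n))) \<le> (\<Sum>i<Suc n. indicator A ((\<phi> ^^ i) (x n)) :: real)) \<Longrightarrow>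
      measure \<nu> B \<le> measure \<nu> A"
proof -
  define a :: "nat \<Rightarrow> 'a set \<Rightarrow> real"
    where "a n U = (\<Sum>i<Suc n. indicator U ((\<phi> ^^ i) (x n))) / real (Suc n)" for n U
  have a01: "a n U \<in> {0..1}" for n U
  proof -
    have "(\<Sum>i<Suc n. indicator U ((\<phi> ^^ i) (x n)) :: real) \<le> (\<Sum>i<Suc n. 1)"
      by (intro sum_mono) (auto simp: indicator_def)
    moreover have "0 \<le> (\<Sum>i<Suc n. indicator U ((\<phi> ^^ i) (x n)) :: real)"
      by (intro sum_nonneg) auto
    ultimately show ?thesis by (simp add: a_def divide_simps del: sum.lessThan_Suc)
  qed
  obtain G m where G: "G \<noteq> bot" "G \<le> sequentially" and m: "\<And>U. ((\<lambda>n. a n U) \<longlongrightarrow> m U) G"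
    using cluster_content[of a] a01 by metis
  have m_nonneg: "0 \<le> m U" for U
    by (rule tendsto_lowerbound[OF m _ G(1)]) (use a01 in auto)
  have m_UNIV: "m UNIV = 1"
    using tendsto_unique[OF G(1) m[of UNIV], of 1] by (simp add: a_def del: sum.lessThan_Suc)
  have m_add: "m (U \<union> V) = m U + m V" if "U \<inter> V = {}" for U V
  proof -
    have "a n (U \<union> V) = a n U + a n V" for n
      using that by (simp add: a_def indicator_add sum.distrib[symmetric] add_divide_distrib[symmetric] del: sum.lessThan_Suc)
    then show ?thesis
      using tendsto_unique[OF G(1) m[of "U \<union> V"], of "m U + m V"] tendsto_add[OF m[of U] m[of V]] by simp
  qed
  have m_inv: "m (\<phi> -` U) = m U" for U
  proof -
    \<comment> \<open>Shifting the segment by one changes only its two end terms, so the defect of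
      invariance is at most \<open>1/(n+1)\<close> and vanishes along \<open>G\<close>.\<close>
    have "\<bar>a n (\<phi> -` U) - a n U\<bar> \<le> inverse (real (Suc n))" for n
    proof -
      have "a n (\<phi> -` U) - a n U = (\<Sum>i<Suc n. indicator U ((\<phi> ^^ Suc i) (x n)) - indicator U ((\<phi> ^^ i) (x n))) / real (Suc n)"
        by (simp add: a_def sum_subtractf diff_divide_distrib indicator_vimage del: sum.lessThan_Suc)
      also have "\<dots> = (indicator U ((\<phi> ^^ Suc n) (x n)) - indicator U (x n)) / real (Suc n)"
        by (subst sum_lessThan_telescope) simp
      finally have *: "a n (\<phi> -` U) - a n U = (indicator U ((\<phi> ^^ Suc n) (x n)) - indicator U (x n)) / real (Suc n)" .
      show ?thesis unfolding * by (simp add: abs_divide divide_simps indicator_def)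
    qed
    then have "\<forall>\<^sub>F n in G. norm (a n (\<phi> -` U) - a n U) \<le> inverse (real (Suc n))" by simp
    moreover have "((\<lambda>n. inverse (real (Suc n))) \<longlongrightarrow> 0) G"
      using tendsto_mono[OF G(2) LIMSEQ_inverse_real_of_nat] .
    ultimately have "((\<lambda>n. a n (\<phi> -` U) - a n U) \<longlongrightarrow> 0) G"
      by (rule Lim_null_comparison)
    then show ?thesis
      using tendsto_unique[OF G(1) tendsto_diff[OF m[of "\<phi> -` U"] m[of U]], of 0] by simp
  qed
  obtain \<nu> where \<nu>: "sets \<nu> = sets borel" "\<And>U. clopen U \<Longrightarrow> emeasure \<nu> U = ennreal (m U)"
    using clopen_content_extends[of m] m_nonneg m_add by metis
  have sp: "space \<nu> = UNIV" using sets_eq_imp_space_eq[OF \<nu>(1)] by simp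
  have meas: "measure \<nu> U = m U" if "clopen U" for U
    using \<nu>(2)[OF that] m_nonneg by (simp add: measure_def)
  have phi: "\<phi> \<in> measurable \<nu> borel"
    using assms \<nu>(1) borel_measurable_continuous_onI[of \<phi>] by (auto simp: Homeo_iff cong: measurable_cong_sets)
  have "distr \<nu> borel \<phi> = \<nu>"
  proof (rule measure_eqI_clopen)
    show "emeasure (distr \<nu> borel \<phi>) UNIV \<noteq> \<infinity>"
      using phi by (simp add: emeasure_distr sp \<nu>(2) clopen_UNIV)
    show "emeasure (distr \<nu> borel \<phi>) U = emeasure \<nu> U" if "clopen U" for U
      using phi that
      by (simp add: emeasure_distr clopen_borel sp \<nu>(2) Homeo_clopen_vimage[OF assms] m_inv)
  qed (use \<nu> in auto)
  then have "emeasure \<nu> (\<phi> -` A) = emeasure \<nu> A" if "A \<in> sets borel" for A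
    using emeasure_distr[OF phi that] by (simp add: sp)
  moreover have "prob_space \<nu>"
    by (rule prob_spaceI) (simp add: sp \<nu>(2) clopen_UNIV m_UNIV)
  ultimately have "invariant_prob \<phi> \<nu>"
    using \<nu>(1) by (simp add: invariant_prob_def)
  then show ?thesis
  proof (rule that)
    fix A B :: "'a set"
    assume AB: "clopen A" "clopen B" and
      le: "\<And>n. (\<Sum>i<Suc n. indicator B ((\<phi> ^^ i) (x n))) \<le> (\<Sum>i<Suc n. indicator A ((\<phi> ^^ i) (x n)) :: real)"
    have "a n B \<le> a n A" for n
      unfolding a_def by (rule divide_right_mono[OF le]) simp
    then have "m B \<le> m A"
      by (intro tendsto_le[OF G(1) m m]) auto
    then show "measure \<nu> B \<le> measure \<nu> A" using AB meas by simp
  qed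
qed

locale uniquely_ergodic_cantor = cantor_minimal ty \<phi> for ty :: "'a::topological_space itself" and \<phi> +
  fixes \<mu> :: "'a measure"
  assumes inv: "invariant_prob \<phi> \<mu>"
    and uniq: "\<And>\<nu>. invariant_prob \<phi> \<nu> \<Longrightarrow> \<nu> = \<mu>"
begin

sublocale prob_space \<mu>
  using inv by (simp add: invariant_prob_def)

lemma sets_mu [simp]: "sets \<mu> = sets borel"
  using inv by (simp add: invariant_prob_def)

lemma space_mu [simp]: "space \<mu> = UNIV"
  using sets_eq_imp_space_eq[OF sets_mu] by simp

lemma positive_sums:
  assumes "clopen A" "clopen B" "measure \<mu> A < measure \<mu> B"
  shows "\<exists>N. \<forall>x. 0 < (\<Sum>i<N. indicator B ((\<phi> ^^ i) x) - indicator A ((\<phi> ^^ i) x) :: int)"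
proof (rule ccontr)
  assume "\<not> ?thesis"
  then have "\<forall>n. \<exists>x. (\<Sum>i<Suc n. indicator B ((\<phi> ^^ i) x) - indicator A ((\<phi> ^^ i) x) :: int) \<le> 0"
    by (meson not_less)
  then obtain x where x: "\<And>n. (\<Sum>i<Suc n. indicator B ((\<phi> ^^ i) (x n)) - indicator A ((\<phi> ^^ i) (x n)) :: int) \<le> 0"
    by metis
  have of_int_ind: "real_of_int (indicator U y) = indicator U y" for U and y :: 'a
    by (simp add: indicator_def)
  have x': "(\<Sum>i<Suc n. indicator B ((\<phi> ^^ i) (x n))) \<le> (\<Sum>i<Suc n. indicator A ((\<phi> ^^ i) (x n)) :: real)" for n
  proof -
    have "real_of_int (\<Sum>i<Suc n. indicator B ((\<phi> ^^ i) (x n)) - indicator A ((\<phi> ^^ i) (x n)) :: int) \<le> 0"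
      using x[of n] by linarith
    then show ?thesis by (simp add: sum_subtractf of_int_ind del: sum.lessThan_Suc)
  qed
  obtain \<nu> where "invariant_prob \<phi> \<nu>" and "measure \<nu> B \<le> measure \<nu> A"
    using invariant_measure_limit[OF Homeo_phi, of x] assms(1,2) x' by metis
  then show False using uniq assms(3) by force
qed

end

section \<open>Matching along orbits\<close>

lemma Homeo_borel_image:
  assumes "h \<in> Homeo" "A \<in> sets borel"
  shows "h ` A \<in> sets borel"
proof -
  have "inv h \<in> borel_measurable borel"
    using assms(1) by (auto simp: Homeo_iff intro: borel_measurable_continuous_onI)
  then show ?thesis
    using assms measurable_sets[of "inv h" borel borel A] by (simp add: Homeo_image)
qed

context uniquely_ergodic_cantor
begin

lemma emeasure_phi_image:
  assumes "A \<in> sets borel"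
  shows "emeasure \<mu> (\<phi> ` A) = emeasure \<mu> A"
proof -
  have "\<phi> -` (\<phi> ` A) = A" using bij_phi by (simp add: bij_is_inj inj_vimage_image_eq)
  then show ?thesis
    using inv Homeo_borel_image[OF Homeo_phi assms] by (metis invariant_prob_def)
qed

lemma emeasure_int_iterate_image:
  assumes "A \<in> sets borel"
  shows "emeasure \<mu> (int_iterate \<phi> n ` A) = emeasure \<mu> A"
proof (induction n rule: int_induct[of _ 0])
  case base
  then show ?case by (simp add: int_iterate_0)
next
  case (step1 i)
  have "emeasure \<mu> (\<phi> ` int_iterate \<phi> i ` A) = emeasure \<mu> (int_iterate \<phi> i ` A)"
    by (intro emeasure_phi_image Homeo_borel_image Homeo_int_iterate Homeo_phi assms)
  then show ?case
    using step1 by (simp add: int_iterate_Suc[OF bij_phi] image_comp)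
next
  case (step2 i)
  have "emeasure \<mu> (\<phi> ` int_iterate \<phi> (i - 1) ` A) = emeasure \<mu> (int_iterate \<phi> (i - 1) ` A)"
    by (intro emeasure_phi_image Homeo_borel_image Homeo_int_iterate Homeo_phi assms)
  then show ?case
    using step2 int_iterate_Suc[OF bij_phi, of "i - 1"] by (simp add: image_comp)
qed

text \<open>The closed sets \<open>E k\<close> on which \<open>g\<close> equals a single power of
  \<open>\<phi>\<close> cover the space. They cut \<open>A\<close> into disjoint pieces moved by
  powers, which preserve \<open>\<mu>\<close>. Since exponents need not be locally constant, the
  pieces are only Borel.\<close>

lemma measure_full_group_image:
  assumes g: "g \<in> full_group \<phi>" and A: "A \<in> sets borel"
  shows "measure \<mu> (g ` A) = measure \<mu> A"
proof -
  define E where "E k = {x. g x = int_iterate \<phi> (from_nat k) x}" for k :: nat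
  have gH: "g \<in> Homeo" and inj: "inj g" using g full_group_bij[OF g] by (auto simp: full_group_def bij_def)
  have "closed (E k)" for k
    unfolding E_def using gH Homeo_int_iterate[OF Homeo_phi]
    by (intro closed_Collect_eq) (auto simp: Homeo_iff)
  then have E: "range E \<subseteq> sets borel" by auto
  have UE: "(\<Union>k. E k) = UNIV"
  proof -
    have "x \<in> (\<Union>k. E k)" for x
    proof -
      obtain n where "g x = int_iterate \<phi> n x" using g by (auto simp: full_group_def)
      then have "x \<in> E (to_nat n)" by (simp add: E_def)
      then show ?thesis by blast
    qed
    then show ?thesis by auto
  qed
  define D where "D k = A \<inter> disjointed E k" for k
  have DE: "D k \<subseteq> E k" for k using disjointed_subset[of E k] by (auto simp: D_def)
  have Db: "D k \<in> sets borel" for k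
    using sets.range_disjointed_sets[OF E] A by (auto simp: D_def)
  have dD: "disjoint_family D"
    using disjoint_family_disjointed[of E] by (auto simp: D_def disjoint_family_on_def)
  have UD: "(\<Union>k. D k) = A"
    using UE UN_disjointed_eq[of E] by (auto simp: D_def)
  have gD: "g ` D k = int_iterate \<phi> (from_nat k) ` D k" for k
    using DE[of k] by (intro image_cong) (auto simp: E_def)
  have "emeasure \<mu> (g ` A) = emeasure \<mu> (\<Union>k. g ` D k)"
    by (simp add: UD[symmetric] image_UN)
  also have "\<dots> = (\<Sum>k. emeasure \<mu> (g ` D k))"
  proof (rule suminf_emeasure[symmetric])
    show "range (\<lambda>k. g ` D k) \<subseteq> sets \<mu>" using Homeo_borel_image[OF gH Db] by auto
    show "disjoint_family (\<lambda>k. g ` D k)"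
      using dD inj by (auto simp: disjoint_family_on_def image_Int[symmetric])
  qed
  also have "\<dots> = (\<Sum>k. emeasure \<mu> (D k))"
    by (simp add: gD emeasure_int_iterate_image[OF Db])
  also have "\<dots> = emeasure \<mu> (\<Union>k. D k)"
    using Db dD by (intro suminf_emeasure) auto
  finally show ?thesis by (simp add: UD measure_def)
qed

text \<open>By minimality the translates of \<open>U\<close> under all powers of
  \<open>\<phi>\<close> cover the space, and countably many null sets cannot.\<close>

lemma measure_clopen_pos:
  assumes "clopen U" "U \<noteq> {}"
  shows "0 < measure \<mu> U"
proof (rule ccontr)
  assume "\<not> ?thesis"
  then have "emeasure \<mu> U = 0" by (simp add: emeasure_eq_measure measure_nonneg not_less measure_le_0_iff)
  then have "int_iterate \<phi> n ` U \<in> null_sets \<mu>" for n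
    using emeasure_int_iterate_image[OF clopen_borel[OF assms(1)], of n]
      Homeo_borel_image[OF Homeo_int_iterate[OF Homeo_phi] clopen_borel[OF assms(1)]] by auto
  then have "(\<Union>n. int_iterate \<phi> n ` U) \<in> null_sets \<mu>" by blast
  moreover have "(\<Union>n. int_iterate \<phi> n ` U) = UNIV"
  proof -
    have "x \<in> (\<Union>n. int_iterate \<phi> n ` U)" for x
    proof -
      obtain n where "int_iterate \<phi> n x \<in> U"
        using orbit_meets assms by (auto simp: clopen_def)
      then have "x \<in> int_iterate \<phi> (- n) ` U"
        using int_iterate_minus[OF bij_phi] by (metis image_eqI)
      then show ?thesis by blast
    qed
    then show ?thesis by auto
  qed
  ultimately show False using emeasure_space_1 by auto
qed

text \<open>An atom would share its mass with infinitely many points of its orbit, pushing the total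
  above 1.\<close>

lemma measure_singleton: "measure \<mu> {x} = 0"
proof (rule ccontr)
  assume "measure \<mu> {x} \<noteq> 0"
  then have p: "measure \<mu> {x} > 0" by (simp add: zero_less_measure_iff)
  have bor: "{y} \<in> sets borel" for y :: 'a using finite_closed[of "{y}"] by auto
  have eq: "measure \<mu> {y} = measure \<mu> {x}" if "y \<in> range (\<lambda>n. int_iterate \<phi> n x)" for y
    using that measure_full_group_image[OF int_iterate_in_full_group bor[of x]] by auto
  obtain k :: nat where k: "1 < real k * measure \<mu> {x}"
    using reals_Archimedean3[OF p] by blast
  obtain F where F: "F \<subseteq> range (\<lambda>n. int_iterate \<phi> n x)" "finite F" "card F = k"
    using infinite_arbitrarily_large[OF infinite_orbit] by metis
  have "measure \<mu> F = (\<Sum>y\<in>F. measure \<mu> {y})"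
    using F bor by (intro finite_measure_eq_sum_singleton) auto
  also have "\<dots> = real k * measure \<mu> {x}"
    using F eq by (simp add: subset_eq)
  finally show False using k prob_le_1[of F] by simp
qed

lemma small_clopen_nbhd:
  assumes "0 < e" "open V" "x \<in> V"
  obtains U where "clopen U" "x \<in> U" "U \<subseteq> V" "measure \<mu> U < e"
proof -
  obtain W where W: "\<And>n. clopen (W n)" "\<And>n. x \<in> W n" "decseq W"
    "\<And>V. open V \<Longrightarrow> x \<in> V \<Longrightarrow> \<exists>n. W n \<subseteq> V"
    using clopen_nbhd_seq[of x] by metis
  have "(\<Inter>n. W n) = {x}"
  proof -
    have "y \<notin> (\<Inter>n. W n)" if "y \<noteq> x" for y
      using that W(4)[of "- {y}"] finite_closed[of "{y}"] by auto
    then show ?thesis using W(2) by auto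
  qed
  moreover have "range W \<subseteq> sets borel" using W(1) clopen_borel by auto
  ultimately have "(\<lambda>n. measure \<mu> (W n)) \<longlonglongrightarrow> 0"
    using finite_Lim_measure_decseq[of W] W(3) by (simp add: measure_singleton)
  then have "eventually (\<lambda>n. measure \<mu> (W n) < e) sequentially"
    using assms(1) by (rule order_tendstoD)
  then obtain n where n: "\<And>k. k \<ge> n \<Longrightarrow> measure \<mu> (W k) < e" by (auto simp: eventually_sequentially)
  obtain j where j: "W j \<subseteq> V" using W(4)[OF assms(2,3)] by blast
  have "W (max n j) \<subseteq> V" using j decseqD[OF W(3), of j "max n j"] by auto
  then show ?thesis using W n[of "max n j"] by (intro that[of "W (max n j)"]) auto
qed

text \<open>Strict inequality bounds the matching time by a constant \<open>N\<close>, so partners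
  are given by finitely many powers of \<open>\<phi>\<close> on clopen pieces, and the involution is
  continuous.\<close>

lemma exchange_into:
  assumes "clopen A" "clopen B" "A \<inter> B = {}" "measure \<mu> A < measure \<mu> B"
  obtains h where "h \<in> full_group \<phi>" "h \<circ> h = id" "h ` A \<subseteq> B" "\<And>x. x \<notin> A \<union> h ` A \<Longrightarrow> h x = x"
proof -
  define f where "f x = (indicator B x - indicator A x :: int)" for x
  define S where "S n x = (\<Sum>i<n. f ((\<phi> ^^ i) x))" for n x
  have S_add: "S (m + n) x = S m x + S n ((\<phi> ^^ m) x)" for m n x
    by (induction n) (simp_all add: S_def funpow_add add.commute[of m])
  obtain N where N: "\<And>x. 0 < S N x"
    using positive_sums[OF assms(1,2,4)] by (auto simp: S_def f_def)
  \<comment> \<open>Read \<open>A\<close> as opening and \<open>B\<close> as closing parentheses along the orbit: the one opened at \<open>x \<in> A\<close>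
    is closed where the partial sums first return to 0, which happens before time \<open>N\<close>.\<close>
  define t where "t x = (LEAST n. 0 < n \<and> S n x = 0)" for x
  have t: "0 < t x \<and> S (t x) x = 0 \<and> t x \<le> N \<and> (\<forall>j. 0 < j \<and> j < t x \<longrightarrow> S j x < 0)" if "x \<in> A" for x
  proof -
    have S1: "S 1 x = -1" using that assms(3) by (auto simp: S_def f_def indicator_def)
    \<comment> \<open>The sum starts at -1 and rises by at most 1 per step, so it cannot become
      positive, as it is at time \<open>N\<close>, without passing through 0.\<close>
    have neg: "S j x < 0" if "0 < j" "\<And>i. 0 < i \<Longrightarrow> i \<le> j \<Longrightarrow> S i x \<noteq> 0" for j
      using that
    proof (induction j)
      case (Suc j)
      show ?case
      proof (cases "j = 0")
        case True then show ?thesis using S1 by simp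
      next
        case False
        then have "S j x < 0" using Suc by simp
        moreover have "S (Suc j) x = S j x + f ((\<phi> ^^ j) x)" by (simp add: S_def)
        moreover have "f y \<le> 1" for y by (simp add: f_def indicator_def)
        ultimately have "S (Suc j) x \<le> 0" by (smt (verit))
        then show ?thesis using Suc.prems(2)[of "Suc j"] by simp
      qed
    qed simp
    have "N > 0" using N[of x] by (cases N) (auto simp: S_def)
    then have "\<exists>n. 0 < n \<and> S n x = 0 \<and> n \<le> N"
      using neg[of N] N[of x] by (metis not_less_iff_gr_or_eq)
    then obtain n where n: "0 < n \<and> S n x = 0" "n \<le> N" by blast
    have "0 < t x \<and> S (t x) x = 0" unfolding t_def by (rule LeastI[of _ n]) (use n in simp)
    moreover have "t x \<le> n" unfolding t_def by (rule Least_le) (use n in simp)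
    moreover have "S j x \<noteq> 0" if "0 < j" "j < t x" for j
      using not_less_Least[of j "\<lambda>n. 0 < n \<and> S n x = 0"] that by (auto simp: t_def)
    then have "\<forall>j. 0 < j \<and> j < t x \<longrightarrow> S j x < 0" using neg by (meson le_less_trans)
    ultimately show ?thesis using n(2) by simp
  qed
  \<comment> \<open>\<open>S n\<close> sums over indices below \<open>n\<close>, so the term that
    brings the sum back to 0 at time \<open>t x\<close> sits at index
    \<open>t x - 1\<close>.\<close>
  define \<theta> where "\<theta> x = (\<phi> ^^ (t x - 1)) x" for x
  have \<theta>B: "\<theta> x \<in> B" if "x \<in> A" for x
  proof -
    have "f x = -1" using that assms(3) by (auto simp: f_def indicator_def)
    obtain k where k: "t x = Suc k" using t[OF \<open>x \<in> A\<close>] by (cases "t x") auto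
    have "k \<noteq> 0" using t[OF that] \<open>f x = -1\<close> k by (auto simp: S_def)
    then have "S k x < 0" "S (t x) x = S k x + f (\<theta> x)"
      using t[OF that] k by (auto simp: S_def \<theta>_def)
    then have "f (\<theta> x) > 0" using t[OF that] by simp
    then show ?thesis by (auto simp: f_def indicator_def split: if_splits)
  qed
  \<comment> \<open>If a later opening \<open>y\<close> on the orbit of \<open>x\<close> had the
    same partner, the sum from \<open>x\<close> to its return would be the part before
    \<open>y\<close> plus the return of \<open>y\<close>, which is 0. The part before
    \<open>y\<close> would then be 0 already before the first return of \<open>x\<close>.\<close>
  have \<theta>inj': False if "x \<in> A" "y \<in> A" "y = (\<phi> ^^ m) x" "0 < m" "m + (t y - 1) = t x - 1" for x y m
  proof -
    have "t x = m + t y" using that(5) t[OF that(1)] t[OF that(2)] by linarith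
    then have "S (t x) x = S m x + S (t y) y" using S_add[of m "t y" x] that(3) by simp
    moreover have "S m x < 0" using t[OF that(1)] t[OF that(2)] \<open>t x = m + t y\<close> \<open>0 < m\<close> by simp
    ultimately show False using t[OF that(1)] t[OF that(2)] by simp
  qed
  have \<theta>inj_le: "x = y" if "x \<in> A" "y \<in> A" "\<theta> x = \<theta> y" "t y \<le> t x" for x y
  proof -
    have "(\<phi> ^^ (t y - 1)) ((\<phi> ^^ (t x - t y)) x) = (\<phi> ^^ (t y - 1)) y"
      using that t[OF that(2)] t[OF that(1)]
      by (simp add: \<theta>_def flip: funpow_add[THEN fun_cong, unfolded comp_def])
    then have "y = (\<phi> ^^ (t x - t y)) x"
      using bij_is_inj[OF bij_fn[OF bij_phi]] by (metis injD)
    moreover have "t x - t y + (t y - 1) = t x - 1" using that(4) t[OF that(2)] by linarith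
    ultimately have "t x - t y = 0"
      using \<theta>inj'[OF that(1,2), of "t x - t y"] by blast
    then show ?thesis using \<open>y = (\<phi> ^^ (t x - t y)) x\<close> by simp
  qed
  have \<theta>inj: "inj_on \<theta> A"
    by (rule inj_onI) (metis \<theta>inj_le nle_le)
  define P where "P n = {x \<in> A. t x = n}" for n
  \<comment> \<open>The summand is constant on each of the clopen sets \<open>A\<close>,
    \<open>B\<close> and the rest, so partial sums are locally constant.\<close>
  have clopen_level: "clopen {x. S n x = c}" for n c
  proof (induction n arbitrary: c)
    case 0
    then show ?case by (cases "c = 0") (auto simp: S_def clopen_UNIV clopen_empty)
  next
    case (Suc n)
    have "{x. S (Suc n) x = c} =
      ({x. S n x = c} \<inter> (\<phi> ^^ n) -` (- (A \<union> B))) \<union>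
      ({x. S n x = c + 1} \<inter> (\<phi> ^^ n) -` A) \<union> ({x. S n x = c - 1} \<inter> (\<phi> ^^ n) -` B)"
      using assms(3) by (auto simp: S_def f_def indicator_def split: if_splits)
    moreover have "clopen \<dots>"
      by (intro clopen_Un clopen_Int Suc.IH Homeo_clopen_vimage Homeo_funpow Homeo_phi clopen_Compl assms)
    ultimately show ?case by simp
  qed
  have cP: "clopen (P n)" for n
  proof -
    have "P n = (if n = 0 then {} else A \<inter> {x. S n x = 0} \<inter> (\<Inter>j\<in>{j. 0 < j \<and> j < n}. - {x. S j x = 0}))"
    proof -
      have "t x = n" if "x \<in> A" "0 < n" "S n x = 0" "\<And>j. 0 < j \<Longrightarrow> j < n \<Longrightarrow> S j x \<noteq> 0" for x
        unfolding t_def using that by (intro Least_equality) (auto intro: leI)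
      moreover have "0 < n \<and> S n x = 0 \<and> (\<forall>j. 0 < j \<and> j < n \<longrightarrow> S j x \<noteq> 0)" if "x \<in> P n" for x
        using t[of x] that by (auto simp: P_def)
      ultimately have "x \<in> P n \<longleftrightarrow> x \<in> A \<and> 0 < n \<and> S n x = 0 \<and> (\<forall>j. 0 < j \<and> j < n \<longrightarrow> S j x \<noteq> 0)" for x
        unfolding P_def by blast
      then show ?thesis by (intro set_eqI) simp
    qed
    then show ?thesis
      using assms(1) clopen_level by (auto intro!: clopen_Int clopen_INT clopen_Compl simp: clopen_empty)
  qed
  have UP: "A = (\<Union>n\<in>{..N}. P n)" using t by (auto simp: P_def)
  \<comment> \<open>The truncated subtraction at \<open>n = 0\<close> is harmless, since
    \<open>P 0\<close> is empty.\<close>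
  have \<theta>P: "\<theta> ` P n = (\<phi> ^^ (n - 1)) ` P n" for n by (auto simp: \<theta>_def P_def)
  have cQ: "clopen (\<theta> ` P n)" for n
    unfolding \<theta>P by (intro Homeo_clopen_image Homeo_funpow Homeo_phi cP)
  define h where "h x = (if x \<in> A then \<theta> x else if x \<in> \<theta> ` A then inv_into A \<theta> x else x)" for x
  have disj: "A \<inter> \<theta> ` A = {}" using \<theta>B assms(3) by auto
  have hA: "h x = \<theta> x" if "x \<in> A" for x using that by (simp add: h_def)
  have h\<theta>: "h (\<theta> x) = x" if "x \<in> A" for x
  proof -
    have "\<theta> x \<notin> A" "\<theta> x \<in> \<theta> ` A" using that disj by auto
    then show ?thesis using that by (simp add: h_def \<theta>inj)
  qed
  have hO: "h x = x" if "x \<notin> A" "x \<notin> \<theta> ` A" for x using that by (simp add: h_def)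
  have hh: "h (h x) = x" for x
    using hA h\<theta> hO by (cases "x \<in> A"; cases "x \<in> \<theta> ` A") auto
  have imA: "h ` A = \<theta> ` A" using hA by auto
  have "h \<in> full_group \<phi>"
  proof (rule full_group_glue)
    show "bij h" using hh by (metis bijI')
    fix x
    consider n where "x \<in> P n" | n where "x \<in> \<theta> ` P n" | "x \<in> - (A \<union> \<theta> ` A)"
      using UP by auto
    then show "\<exists>U g. open U \<and> x \<in> U \<and> g \<in> full_group \<phi> \<and> (\<forall>y\<in>U. h y = g y)"
    proof cases
      case 1
      have "h y = int_iterate \<phi> (int (n - 1)) y" if "y \<in> P n" for y
        unfolding int_iterate_of_nat using that by (simp add: hA P_def \<theta>_def)
      then show ?thesis using 1 cP[of n] int_iterate_in_full_group unfolding clopen_def by blast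
    next
      case 2
      have "h y = int_iterate \<phi> (- int (n - 1)) y" if "y \<in> \<theta> ` P n" for y
      proof -
        obtain z where z: "z \<in> A" "t z = n" "y = \<theta> z" using \<open>y \<in> \<theta> ` P n\<close> by (auto simp: P_def)
        then have "y = int_iterate \<phi> (int (n - 1)) z"
          unfolding int_iterate_of_nat by (simp add: \<theta>_def)
        then show ?thesis using z h\<theta>[OF z(1)] int_iterate_minus[OF bij_phi] by metis
      qed
      then show ?thesis using 2 cQ[of n] int_iterate_in_full_group unfolding clopen_def by blast
    next
      case 3
      have "clopen (\<theta> ` A)" using clopen_UN[of "{..N}" "\<lambda>n. \<theta> ` P n"] cQ UP by (simp add: image_UN[symmetric])
      then have "open (- (A \<union> \<theta> ` A))" using assms(1) by (auto simp: clopen_def intro: open_Compl)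
      then show ?thesis using 3 hO full_group_id
        by (intro exI[of _ "- (A \<union> \<theta> ` A)"] exI[of _ id]) auto
    qed
  qed
  moreover have "h \<circ> h = id" using hh by auto
  moreover have "h ` A \<subseteq> B" using imA \<theta>B by auto
  moreover have "h x = x" if "x \<notin> A \<union> h ` A" for x using that hO imA by auto
  ultimately show ?thesis by (rule that)
qed

end

section \<open>Exchanging clopen sets of equal measure\<close>

text \<open>The condition on the support is included so that exchanges on disjoint regions can be
  composed.\<close>

definition exchanges :: "('a::topological_space \<Rightarrow> 'a) \<Rightarrow> ('a \<Rightarrow> 'a) \<Rightarrow> 'a set \<Rightarrow> 'a set \<Rightarrow> bool" where
  "exchanges \<phi> h P Q \<longleftrightarrow>
     h \<in> full_group \<phi> \<and> (\<forall>z. h (h z) = z) \<and> h ` P = Q \<and> (\<forall>z. z \<notin> P \<union> Q \<longrightarrow> h z = z)"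

lemma exchanges_sym:
  assumes "exchanges \<phi> h P Q"
  shows "exchanges \<phi> h Q P"
proof -
  have "h (h z) = z" "Q = h ` P" for z using assms unfolding exchanges_def by blast+
  then have "h ` Q = P" by (simp add: image_image)
  then show ?thesis using assms unfolding exchanges_def by blast
qed

lemma exchangesD:
  assumes "exchanges \<phi> h P Q"
  shows "h \<in> full_group \<phi>" "h (h z) = z" "h ` P = Q" "z \<in> P \<Longrightarrow> h z \<in> Q" "z \<in> Q \<Longrightarrow> h z \<in> P"
    "z \<notin> P \<Longrightarrow> z \<notin> Q \<Longrightarrow> h z = z"
  using assms exchanges_sym[OF assms] unfolding exchanges_def by blast+

context uniquely_ergodic_cantor
begin

lemma exchanges_id: "exchanges \<phi> id {} {}"
  by (simp add: exchanges_def full_group_id)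

lemma exchanges_Un:
  assumes h: "exchanges \<phi> h P Q" and k: "exchanges \<phi> k P' Q'" and d: "(P \<union> Q) \<inter> (P' \<union> Q') = {}"
  shows "exchanges \<phi> (k \<circ> h) (P \<union> P') (Q \<union> Q')"
proof -
  note hD = exchangesD[OF h] and kD = exchangesD[OF k]
  have 1: "k (h z) = h z" if "z \<in> P \<union> Q" for z
    using hD(4,5)[of z] kD(6)[of "h z"] that d by blast
  have 2: "k (h z) = k z" if "z \<notin> P \<union> Q" for z
    using hD(6)[of z] that by simp
  have "k (h (k (h z))) = z" for z
  proof (cases "z \<in> P \<union> Q")
    case True
    then have "k z = z" using d kD(6)[of z] by blast
    then show ?thesis using 1[OF True] hD(2) by simp
  next
    case False
    have "k z \<notin> P \<union> Q"
      using False d kD(4,5,6)[of z] by (metis IntI UnI1 UnI2 empty_iff)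
    then show ?thesis using 2[OF False] 2[of "k z"] kD(2) by simp
  qed
  moreover have "(k \<circ> h) ` (P \<union> P') = Q \<union> Q'"
  proof -
    have "(k \<circ> h) ` P = h ` P" using 1 by (intro image_cong) simp_all
    moreover have "(k \<circ> h) ` P' = k ` P'" using 2 d by (intro image_cong) auto
    ultimately show ?thesis using hD(3) kD(3) by (simp only: image_Un)
  qed
  moreover have "k \<circ> h \<in> full_group \<phi>" using hD(1) kD(1) by (rule full_group_comp[rotated])
  moreover have "(k \<circ> h) z = z" if "z \<notin> (P \<union> P') \<union> (Q \<union> Q')" for z
    using that hD(6)[of z] kD(6)[of z] by simp
  ultimately show ?thesis unfolding exchanges_def by simp
qed

lemma measure_clopen_Diff: "clopen A \<Longrightarrow> clopen B \<Longrightarrow> B \<subseteq> A \<Longrightarrow> measure \<mu> (A - B) = measure \<mu> A - measure \<mu> B"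
  by (intro finite_measure_Diff) (auto intro: clopen_borel)

text \<open>The strict inequality for \<open>exchange_into\<close> is created by setting aside
  \<open>A'\<close> around \<open>x\<close> and a neighbourhood \<open>B0\<close> of
  \<open>y\<close> of smaller measure. The unmatched part of \<open>B\<close> contains
  \<open>B0\<close>, hence \<open>y\<close>, and has the measure of \<open>A'\<close>, but it need
  not be close to \<open>y\<close>.\<close>

lemma exchange_outside_nbhd:
  assumes A: "clopen A" and B: "clopen B" and d: "A \<inter> B = {}" and m: "measure \<mu> A = measure \<mu> B"
    and x: "x \<in> A" and y: "y \<in> B" and V: "open V" "x \<in> V"
  obtains A' B' h where "clopen A'" "clopen B'" "measure \<mu> A' = measure \<mu> B'"
    "x \<in> A'" "y \<in> B'" "A' \<subseteq> A \<inter> V" "B' \<subseteq> B" "exchanges \<phi> h (A - A') (B - B')"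
proof -
  obtain A' where A': "clopen A'" "x \<in> A'" "A' \<subseteq> A \<inter> V"
    using clopen_nbhd[of "A \<inter> V" x] A V x by (auto simp: clopen_def)
  have "0 < measure \<mu> A'" using A' by (intro measure_clopen_pos) auto
  then obtain B0 where B0: "clopen B0" "y \<in> B0" "B0 \<subseteq> B" "measure \<mu> B0 < measure \<mu> A'"
    using small_clopen_nbhd[of "measure \<mu> A'" B y] B y by (auto simp: clopen_def)
  have "measure \<mu> (A - A') < measure \<mu> (B - B0)"
    using A A' B B0 m by (simp add: measure_clopen_Diff)
  moreover have "(A - A') \<inter> (B - B0) = {}" using d by auto
  ultimately obtain h where h: "h \<in> full_group \<phi>" "h \<circ> h = id" "h ` (A - A') \<subseteq> B - B0"
      "\<And>z. z \<notin> (A - A') \<union> h ` (A - A') \<Longrightarrow> h z = z"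
    using exchange_into[of "A - A'" "B - B0"] A A' B B0 by (metis clopen_Diff)
  define E where "E = h ` (A - A')"
  have E: "clopen E" unfolding E_def using A A' h(1) by (intro full_group_clopen_image clopen_Diff) auto
  have mE: "measure \<mu> E = measure \<mu> A - measure \<mu> A'"
    unfolding E_def using measure_full_group_image[OF h(1)] A A'
    by (simp add: measure_clopen_Diff clopen_borel clopen_Diff)
  have EB: "E \<subseteq> B" using h(3) by (auto simp: E_def)
  show ?thesis
  proof (rule that)
    show "clopen A'" "x \<in> A'" "A' \<subseteq> A \<inter> V" "B - E \<subseteq> B" using A' by auto
    show "clopen (B - E)" using B E by (rule clopen_Diff)
    show "y \<in> B - E" using y B0 h(3) by (auto simp: E_def)
    show "measure \<mu> A' = measure \<mu> (B - E)" using B E EB mE m by (simp add: measure_clopen_Diff)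
    have "B - (B - E) = E" using EB by auto
    moreover have "h (h z) = z" for z using h(2) by (metis comp_apply id_apply)
    then have "exchanges \<phi> h (A - A') E"
      using h(1,4) unfolding exchanges_def E_def by blast
    ultimately show "exchanges \<phi> h (A - A') (B - (B - E))" by simp
  qed
qed

text \<open>One application confines the remainder on the side of \<open>x\<close> only; a second
  one, with the two sides swapped, confines the side of \<open>y\<close> and merely shrinks the
  other.\<close>

lemma exchange_outside_nbhds:
  assumes A: "clopen A" and B: "clopen B" and d: "A \<inter> B = {}" and m: "measure \<mu> A = measure \<mu> B"
    and x: "x \<in> A" and y: "y \<in> B" and V: "open V" "x \<in> V" and W: "open W" "y \<in> W"
  obtains A' B' h where "clopen A'" "clopen B'" "measure \<mu> A' = measure \<mu> B'"
    "x \<in> A'" "y \<in> B'" "A' \<subseteq> A \<inter> V" "B' \<subseteq> B \<inter> W" "exchanges \<phi> h (A - A') (B - B')"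
proof -
  obtain A' B' h where 1: "clopen A'" "clopen B'" "measure \<mu> A' = measure \<mu> B'"
    "x \<in> A'" "y \<in> B'" "A' \<subseteq> A \<inter> V" "B' \<subseteq> B" "exchanges \<phi> h (A - A') (B - B')"
    using exchange_outside_nbhd[OF A B d m x y V] by metis
  have d': "B' \<inter> A' = {}" using 1 d by auto
  obtain B'' A'' k where 2: "clopen B''" "clopen A''" "measure \<mu> B'' = measure \<mu> A''"
    "y \<in> B''" "x \<in> A''" "B'' \<subseteq> B' \<inter> W" "A'' \<subseteq> A'" "exchanges \<phi> k (B' - B'') (A' - A'')"
    using exchange_outside_nbhd[OF 1(2,1) d' 1(3)[symmetric] 1(5,4) W] by metis
  have "exchanges \<phi> (k \<circ> h) ((A - A') \<union> (A' - A'')) ((B - B') \<union> (B' - B''))"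
    using 1 2 d by (intro exchanges_Un exchanges_sym[OF 2(8)]) auto
  moreover have "(A - A') \<union> (A' - A'') = A - A''" "(B - B') \<union> (B' - B'') = B - B''"
    using 1 2 by auto
  ultimately show ?thesis using 1 2 by (intro that[of A'' B'' "k \<circ> h"]) auto
qed

lemma exchange_disjoint:
  assumes A: "clopen A" and B: "clopen B" and d: "A \<inter> B = {}" and m: "measure \<mu> A = measure \<mu> B"
  obtains h where "exchanges \<phi> h A B"
proof (cases "A = {} \<or> B = {}")
  case True
  then have "A = {} \<and> B = {}"
    using measure_clopen_pos[OF A] measure_clopen_pos[OF B] m by (metis less_irrefl measure_empty)
  then show ?thesis using exchanges_id that by auto
next
  case False
  then obtain x where x: "x \<in> A" by auto
  obtain N where N: "int_iterate \<phi> N x \<in> B" using orbit_meets[of B x] B False by (auto simp: clopen_def)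
  define y where "y = int_iterate \<phi> N x"
  obtain V where V: "\<And>n. clopen (V n)" "\<And>n. x \<in> V n" "decseq V"
    "\<And>U. open U \<Longrightarrow> x \<in> U \<Longrightarrow> \<exists>n. V n \<subseteq> U" using clopen_nbhd_seq[of x] by metis
  obtain W where W: "\<And>n. clopen (W n)" "\<And>n. y \<in> W n" "decseq W"
    "\<And>U. open U \<Longrightarrow> y \<in> U \<Longrightarrow> \<exists>n. W n \<subseteq> U" using clopen_nbhd_seq[of y] by metis
  \<comment> \<open>The clause for \<open>n = 0\<close> pins the chosen sequence to start at
    \<open>(A, B)\<close>, since dependent choice only promises that its first term satisfies
    \<open>ok 0\<close>.\<close>
  define ok where "ok n = (\<lambda>(A', B'). clopen A' \<and> clopen B' \<and> A' \<inter> B' = {} \<and>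
    measure \<mu> A' = measure \<mu> B' \<and> x \<in> A' \<and> y \<in> B' \<and> (n = 0 \<longrightarrow> A' = A \<and> B' = B))" for n :: nat
  define step where "step n = (\<lambda>(A, B) (A', B'). A' \<subseteq> A \<inter> V n \<and> B' \<subseteq> B \<inter> W n \<and>
    (\<exists>h. exchanges \<phi> h (A - A') (B - B')))" for n
  have "\<exists>f. \<forall>n. ok n (f n) \<and> step n (f n) (f (Suc n))"
  proof (rule dependent_nat_choice)
    show "\<exists>s. ok 0 s" using A B d m x N by (intro exI[of _ "(A, B)"]) (simp add: ok_def y_def)
    fix s n assume "ok n s"
    then obtain A1 B1 where s: "s = (A1, B1)" and *: "clopen A1" "clopen B1" "A1 \<inter> B1 = {}"
      "measure \<mu> A1 = measure \<mu> B1" "x \<in> A1" "y \<in> B1" by (auto simp: ok_def)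
    have "open (V n)" "open (W n)" using V(1) W(1) by (auto simp: clopen_def)
    then obtain A' B' h where "clopen A'" "clopen B'" "measure \<mu> A' = measure \<mu> B'"
      "x \<in> A'" "y \<in> B'" "A' \<subseteq> A1 \<inter> V n" "B' \<subseteq> B1 \<inter> W n" "exchanges \<phi> h (A1 - A') (B1 - B')"
      using exchange_outside_nbhds[OF *, of "V n" "W n"] V(2) W(2) by metis
    then show "\<exists>t. ok (Suc n) t \<and> step n s t"
      using *(3) by (intro exI[of _ "(A', B')"]) (auto simp: ok_def step_def s)
  qed
  then obtain f where f: "\<And>n. ok n (f n)" "\<And>n. step n (f n) (f (Suc n))" by blast
  define a where "a n = fst (f n)" for n
  define b where "b n = snd (f n)" for n
  have ab: "clopen (a n)" "clopen (b n)" "x \<in> a n" "y \<in> b n" for n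
    using f(1)[of n] by (auto simp: ok_def a_def b_def split: prod.splits)
  have ab0: "a 0 = A" "b 0 = B"
    using f(1)[of 0] by (auto simp: ok_def a_def b_def split: prod.splits)
  have abS: "a (Suc n) \<subseteq> a n" "b (Suc n) \<subseteq> b n" "a (Suc n) \<subseteq> V n" "b (Suc n) \<subseteq> W n" for n
    using f(2)[of n] by (auto simp: step_def a_def b_def split: prod.splits)
  have "\<exists>h. exchanges \<phi> h (a n - a (Suc n)) (b n - b (Suc n))" for n
    using f(2)[of n] by (auto simp: step_def a_def b_def split: prod.splits)
  then obtain g where g: "\<And>n. exchanges \<phi> (g n) (a n - a (Suc n)) (b n - b (Suc n))" by metis
  have dec: "a n \<subseteq> a k" "b n \<subseteq> b k" if "k \<le> n" for k n
    using that lift_Suc_antimono_le[of a] lift_Suc_antimono_le[of b] abS(1,2) by auto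
  have dab: "a n \<inter> b k = {}" for n k using dec[of 0 n] dec[of 0 k] d ab0 by auto
  \<comment> \<open>\<open>L n\<close> is the region exchanged by \<open>g n\<close>; these layers
    are disjoint and, together with \<open>x\<close> and \<open>y\<close>, fill
    \<open>A \<union> B\<close>.\<close>
  define L where "L n = (a n - a (Suc n)) \<union> (b n - b (Suc n))" for n
  have level: "k \<le> n" if "z \<in> a k" "z \<in> L n" for z k n
    using that dec(1)[of "Suc n" k] dab[of k n] not_less_eq_eq[of k n] unfolding L_def by blast
  have level': "k \<le> n" if "z \<in> b k" "z \<in> L n" for z k n
    using that dec(2)[of "Suc n" k] dab[of n k] not_less_eq_eq[of k n] unfolding L_def by blast
  have Luniq: "n = k" if "z \<in> L n" "z \<in> L k" for z n k
    using level[of z n k] level[of z k n] level'[of z n k] level'[of z k n] that dab[of n k] dab[of k n]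
    by (auto simp: L_def)
  have xyL: "x \<notin> L n" "y \<notin> L n" for n
    using ab[of n] ab[of "Suc n"] dab[of n n] by (auto simp: L_def)
  have "x \<noteq> y" using ab(3,4)[of 0] dab[of 0 0] by auto
  \<comment> \<open>A point in no layer stays in every \<open>a n\<close>, hence in every
    \<open>V n\<close>, and these meet only in \<open>x\<close>.\<close>
  have coverA: "z = x \<or> (\<exists>n. z \<in> L n)" if "z \<in> A" for z
  proof (rule ccontr)
    assume *: "\<not> ?thesis"
    then obtain n where "V n \<subseteq> - {z}" using V(4)[of "- {z}"] finite_closed[of "{z}"] by auto
    moreover have "z \<in> a n" for n
      using * that by (induction n) (auto simp: ab0 L_def)
    ultimately show False using abS(3)[of n] by blast
  qed
  have coverB: "z = y \<or> (\<exists>n. z \<in> L n)" if "z \<in> B" for z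
  proof (rule ccontr)
    assume *: "\<not> ?thesis"
    then obtain n where "W n \<subseteq> - {z}" using W(4)[of "- {z}"] finite_closed[of "{z}"] by auto
    moreover have "z \<in> b n" for n
      using * that by (induction n) (auto simp: ab0 L_def)
    ultimately show False using abS(4)[of n] by blast
  qed
  have LAB: "L n \<subseteq> A \<union> B" for n
    using dec[of 0 n] ab0 by (auto simp: L_def)
  \<comment> \<open>\<open>a n\<close> and \<open>b n\<close> shrink to \<open>x\<close> and \<open>y\<close>; swapping these two points keeps \<open>h\<close> in the full group because
    they share an orbit, and \<open>h\<close> is continuous there because it maps \<open>a n\<close> to \<open>b n\<close> and back.\<close>
  define h where "h z = (if z = x then y else if z = y then x
    else if \<exists>n. z \<in> L n then g (THE n. z \<in> L n) z else z)" for z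
  have hx: "h x = y" and hy: "h y = x" using \<open>x \<noteq> y\<close> by (auto simp: h_def)
  have hL: "h z = g n z" if "z \<in> L n" for z n
  proof -
    have "(THE n. z \<in> L n) = n" using that Luniq by blast
    then show ?thesis using that xyL by (auto simp: h_def)
  qed
  have hO: "h z = z" if "z \<notin> A \<union> B" for z
    using that LAB ab(3,4)[of 0] ab0 by (auto simp: h_def)
  have ga: "g n z \<in> b n - b (Suc n)" if "z \<in> a n - a (Suc n)" for n z
    using exchangesD(4)[OF g] that .
  have gb: "g n z \<in> a n - a (Suc n)" if "z \<in> b n - b (Suc n)" for n z
    using exchangesD(5)[OF g] that .
  have hLL: "h z \<in> L n" if "z \<in> L n" for n z
    using that hL[OF that] ga[of z n] gb[of z n] by (auto simp: L_def)
  have hh: "h (h z) = z" for z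
  proof -
    consider "z = x" | "z = y" | n where "z \<in> L n" | "z \<notin> A \<union> B"
      using coverA coverB by blast
    then show ?thesis
    proof cases
      case 3
      then have "h (h z) = g n (g n z)" using hL hLL by metis
      then show ?thesis using exchangesD(2)[OF g] by simp
    qed (auto simp: hx hy hO)
  qed
  have hab: "h z \<in> b n" if "z \<in> a n" for z n
  proof (cases "z = x")
    case True then show ?thesis by (simp add: hx ab)
  next
    case False
    then obtain k where k: "z \<in> L k" using coverA \<open>z \<in> a n\<close> dec(1)[of 0 n] ab0 by auto
    then have "n \<le> k" using level that by blast
    moreover have "z \<in> a k - a (Suc k)" using k that dab[of n k] by (auto simp: L_def)
    ultimately show ?thesis using ga[of z k] dec(2)[of n k] hL[OF k] by auto
  qed
  have hba: "h z \<in> a n" if "z \<in> b n" for z n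
  proof (cases "z = y")
    case True then show ?thesis by (simp add: hy ab)
  next
    case False
    then obtain k where k: "z \<in> L k" using coverB \<open>z \<in> b n\<close> dec(2)[of 0 n] ab0 by auto
    then have "n \<le> k" using level' that by blast
    moreover have "z \<in> b k - b (Suc k)" using k that dab[of k n] by (auto simp: L_def)
    ultimately show ?thesis using gb[of z k] dec(1)[of n k] hL[OF k] by auto
  qed
  have "h \<in> full_group \<phi>"
  proof (rule full_groupI)
    show "bij h" using hh by (metis bijI')
    have cx: "(h \<longlongrightarrow> h x) (at x)"
    proof (rule topological_tendstoI)
      fix U assume U: "open U" "h x \<in> U"
      then obtain n where n: "W n \<subseteq> U" using W(4) hx by auto
      \<comment> \<open>The index is shifted because it is \<open>b (Suc n)\<close> that lies in
        \<open>W n\<close>.\<close>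
      have "\<forall>\<^sub>F z in at x. z \<in> a (Suc n)"
        using ab[of "Suc n"] by (intro eventually_at_in_open') (auto simp: clopen_def)
      then show "\<forall>\<^sub>F z in at x. h z \<in> U"
        by eventually_elim (use hab abS(4) n in blast)
    qed
    have cy: "(h \<longlongrightarrow> h y) (at y)"
    proof (rule topological_tendstoI)
      fix U assume U: "open U" "h y \<in> U"
      then obtain n where n: "V n \<subseteq> U" using V(4) hy by auto
      have "\<forall>\<^sub>F z in at y. z \<in> b (Suc n)"
        using ab[of "Suc n"] by (intro eventually_at_in_open') (auto simp: clopen_def)
      then show "\<forall>\<^sub>F z in at y. h z \<in> U"
        by eventually_elim (use hba abS(3) n in blast)
    qed
    have oL: "open (L n)" for n
    proof -
      have "clopen (L n)" unfolding L_def by (intro clopen_Un clopen_Diff ab)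
      then show ?thesis by (simp add: clopen_def)
    qed
    have oO: "open (- (A \<union> B))" using A B by (auto simp: clopen_def intro: open_Compl)
    have "(h \<longlongrightarrow> h z) (at z)" for z
    proof -
      consider "z = x" | "z = y" | n where "z \<in> L n" | "z \<in> - (A \<union> B)"
        using coverA coverB by blast
      then show ?thesis
      proof cases
        case 3
        show ?thesis
          by (rule continuous_at_glue[OF oL 3, of "g n"]) (use exchangesD(1)[OF g] hL in auto)
      next
        case 4
        show ?thesis
          by (rule continuous_at_glue[OF oO 4 full_group_id]) (use hO in auto)
      qed (use cx cy in auto)
    qed
    then show "continuous_on UNIV h" by (simp add: continuous_on_def)
    show "\<exists>k\<in>full_group \<phi>. h z = k z" for z
    proof -
      consider "z = x" | "z = y" | n where "z \<in> L n" | "z \<notin> A \<union> B"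
        using coverA coverB by blast
      then show ?thesis
      proof cases
        case 1 then show ?thesis using int_iterate_in_full_group hx y_def by blast
      next
        case 2
        have "h z = int_iterate \<phi> (- N) z" using 2 hy int_iterate_minus[OF bij_phi] by (simp add: y_def)
        then show ?thesis using int_iterate_in_full_group by blast
      next
        case 3 then show ?thesis using exchangesD(1)[OF g] hL by blast
      next
        case 4 then show ?thesis using full_group_id hO by (intro bexI[of _ id]) auto
      qed
    qed
  qed
  moreover have "h ` A = B"
    using hab[of _ 0] hba[of _ 0] hh ab0 by (metis image_eqI subsetI subset_antisym image_subsetI)
  ultimately have "exchanges \<phi> h A B" using hh hO unfolding exchanges_def by blast
  then show ?thesis by (rule that)
qed

lemma exchange_symmetric_difference:
  assumes "clopen A" "clopen B" "measure \<mu> A = measure \<mu> B"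
  obtains h where "exchanges \<phi> h (A - B) (B - A)"
proof -
  have "A - B = A - (A \<inter> B)" "B - A = B - (A \<inter> B)" by auto
  then have "measure \<mu> (A - B) = measure \<mu> (B - A)"
    using assms by (simp add: measure_clopen_Diff clopen_Int)
  then show ?thesis
    using exchange_disjoint[of "A - B" "B - A"] assms that by (auto intro: clopen_Diff)
qed

end

section \<open>Elements of finite order\<close>

lemma funpow_fixpoint_dvd:
  assumes "(f ^^ s) x = x" "s dvd t"
  shows "(f ^^ t) x = x"
proof -
  obtain k where "t = s * k" using assms(2) by (rule dvdE)
  moreover have "((f ^^ s) ^^ k) x = x" using assms(1) by (induction k) simp_all
  ultimately show ?thesis by (simp add: funpow_mult)
qed

text \<open>Outside \<open>C\<close>, one step of \<open>h\<close> costs one or two steps of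
  \<open>p \<circ> h\<close>: if \<open>h y\<close> lands in \<open>P\<close>, then \<open>p\<close>
  sends it into \<open>Q\<close>, where \<open>h\<close> is the identity, and the next
  \<open>p\<close> brings it back to \<open>h y\<close>.\<close>

lemma finite_order_comp_exchange:
  fixes p h :: "'a \<Rightarrow> 'a"
  assumes h: "bij h" "finite_order h" "\<And>z. z \<in> C \<Longrightarrow> h z = z"
    and p: "\<And>z. p (p z) = z" "p ` Q = P" "\<And>z. z \<notin> P \<Longrightarrow> z \<notin> Q \<Longrightarrow> p z = z"
    and "Q \<subseteq> C" "P \<inter> C = {}"
  shows "finite_order (p \<circ> h)"
proof -
  define g where "g = p \<circ> h"
  have inj: "inj g" unfolding g_def
    using h(1) p(1) by (intro inj_compose) (auto simp: bij_def inj_def, metis)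
  have hC: "h y \<notin> C" if "y \<notin> C" for y
    using that h(3)[of "h y"] bij_is_inj[OF h(1)] by (metis injD)
  have pP: "p z \<in> Q" if "z \<in> P" for z using that p(1,2) by (metis imageE)
  have step: "\<exists>s. 1 \<le> s \<and> s \<le> 2 \<and> (g ^^ s) y = h y" if y: "y \<notin> C" for y
  proof (cases "h y \<in> P")
    case True
    then have "g (g y) = h y" using pP[OF True] \<open>Q \<subseteq> C\<close> h(3)[of "p (h y)"] p(1) by (auto simp: g_def)
    then show ?thesis by (intro exI[of _ 2]) (simp add: numeral_2_eq_2)
  next
    case False
    then have "g y = h y" using hC[OF y] p(3)[of "h y"] \<open>Q \<subseteq> C\<close> by (auto simp: g_def)
    then show ?thesis by (intro exI[of _ 1]) simp
  qed
  have iter: "\<exists>s. j \<le> s \<and> s \<le> 2 * j \<and> (g ^^ s) y = (h ^^ j) y \<and> (h ^^ j) y \<notin> C" if "y \<notin> C" for y j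
  proof (induction j)
    case (Suc j)
    then obtain s where s: "j \<le> s" "s \<le> 2 * j" "(g ^^ s) y = (h ^^ j) y" "(h ^^ j) y \<notin> C" by auto
    obtain r where r: "1 \<le> r" "r \<le> 2" "(g ^^ r) ((h ^^ j) y) = h ((h ^^ j) y)" using step[OF s(4)] by auto
    have "(g ^^ (r + s)) y = (h ^^ Suc j) y" using s r by (simp add: funpow_add)
    then show ?case using s r hC[OF s(4)] by (intro exI[of _ "r + s"]) auto
  qed (use that in auto)
  obtain m where m: "m > 0" "h ^^ m = id" using h(2) by (auto simp: finite_order_def)
  \<comment> \<open>The return time found for a point lies between \<open>m\<close> and
    \<open>2 * m\<close> and depends on the point; the factorial is a common multiple of all
    candidates.\<close>
  define t :: nat where "t = fact (2 * m)"
  have out: "(g ^^ t) y = y" if y: "y \<notin> C" for y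
  proof -
    obtain s where s: "m \<le> s" "s \<le> 2 * m" "(g ^^ s) y = (h ^^ m) y" using iter[OF y, of m] by auto
    have "s dvd t" unfolding t_def using s m by (intro dvd_fact) auto
    moreover have "(g ^^ s) y = y" using s(3) m(2) by (metis id_apply)
    ultimately show ?thesis by (rule funpow_fixpoint_dvd[rotated])
  qed
  have "(g ^^ t) x = x" for x
  proof (cases "x \<in> C")
    case True
    then have gx: "g x = p x" using h(3) by (simp add: g_def)
    show ?thesis
    proof (cases "x \<in> Q")
      \<comment> \<open>A point of \<open>Q\<close> leaves \<open>C\<close> after one step, and
        injectivity of \<open>g\<close> pulls the period of its image back to it.\<close>
      case True
      then have "g x \<notin> C" using gx p(2) \<open>P \<inter> C = {}\<close> by auto
      then have "g ((g ^^ t) x) = g x" using out[of "g x"] by (simp add: funpow_swap1)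
      then show ?thesis using inj by (metis injD)
    next
      case False
      then have "g x = x" using gx p(3)[of x] True \<open>P \<inter> C = {}\<close> by auto
      then have "(g ^^ 1) x = x" by simp
      then show ?thesis by (rule funpow_fixpoint_dvd) simp
    qed
  qed (rule out)
  moreover have "t > 0" by (simp add: t_def)
  ultimately show ?thesis unfolding finite_order_def g_def[symmetric] by (intro exI[of _ t]) (auto simp: fun_eq_iff)
qed

context uniquely_ergodic_cantor
begin

text \<open>\<open>B\<close> is generalised because the induction hypothesis is applied to images
  under \<open>p\<close>. The support clause makes the smaller map trivial on \<open>A n\<close>,
  which then serves as \<open>C\<close> in \<open>finite_order_comp_exchange\<close>.\<close>

lemma finite_order_match:
  fixes A B :: "'i \<Rightarrow> 'a set"
  assumes "finite I" "\<And>i. i \<in> I \<Longrightarrow> clopen (A i)" "\<And>i. i \<in> I \<Longrightarrow> clopen (B i)"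
    "\<And>i. i \<in> I \<Longrightarrow> measure \<mu> (A i) = measure \<mu> (B i)"
    "disjoint_family_on A I" "disjoint_family_on B I" "(\<Union>i\<in>I. A i) = (\<Union>i\<in>I. B i)"
  shows "\<exists>h\<in>full_group \<phi>. finite_order h \<and> (\<forall>i\<in>I. h ` A i = B i) \<and> (\<forall>z. z \<notin> (\<Union>i\<in>I. A i) \<longrightarrow> h z = z)"
  using assms
proof (induction I arbitrary: B rule: finite_induct)
  case empty
  have "finite_order (id :: 'a \<Rightarrow> 'a)" by (auto simp: finite_order_def intro: exI[of _ 1])
  then show ?case using full_group_id by (metis empty_iff id_apply)
next
  case (insert n I)
  obtain p where p: "exchanges \<phi> p (A n - B n) (B n - A n)"
    using exchange_symmetric_difference[of "A n" "B n"] insert.prems by auto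
  note pD = exchangesD[OF p]
  have inj: "inj p" using pD(2) by (metis injI)
  have dA: "A n \<inter> A i = {}" and dB: "B n \<inter> B i = {}" if "i \<in> I" for i
    using insert.prems(4,5) insert.hyps(2) that by (auto simp: disjoint_family_on_def)
  have pA: "p ` A n = B n"
  proof -
    have "p z = z" if "z \<in> A n \<inter> B n" for z using pD(6) that by blast
    then have "p ` (A n \<inter> B n) = A n \<inter> B n" by force
    moreover have "A n = (A n - B n) \<union> (A n \<inter> B n)" by auto
    ultimately have "p ` A n = (B n - A n) \<union> (A n \<inter> B n)" using pD(3) by (metis image_Un)
    then show ?thesis by auto
  qed
  have pp: "p ` p ` S = S" for S using pD(2) by (simp add: image_image)
  have pB: "p ` B n = A n" using pA pp by metis
  define U where "U = (\<Union>i\<in>insert n I. A i)"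
  have AU: "A n \<subseteq> U" and BU: "B n \<subseteq> U" using insert.prems(6) by (auto simp: U_def)
  have pU: "p z \<in> U" if "z \<in> U" for z
    using pD(4,5,6)[of z] that AU BU by (metis DiffD1 subsetD)
  have pUU: "p ` U = U" using pU pD(2) by (metis image_eqI image_subsetI subsetI subset_antisym)
  define B' where "B' i = p ` B i" for i
  have UA: "(\<Union>i\<in>I. A i) = U - A n" using dA by (auto simp: U_def)
  have UB: "(\<Union>i\<in>I. B i) = U - B n" using dB insert.prems(6) by (auto simp: U_def)
  \<comment> \<open>Since \<open>p\<close> maps \<open>U\<close> onto itself and \<open>B n\<close>
    onto \<open>A n\<close>, the new targets fill exactly what \<open>A n\<close> leaves of
    \<open>U\<close>.\<close>
  have "(\<Union>i\<in>I. B' i) = p ` (U - B n)" unfolding UB[symmetric] B'_def by (simp add: image_UN)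
  also have "\<dots> = U - A n" using inj pUU pB by (simp add: image_set_diff)
  finally have UB': "(\<Union>i\<in>I. A i) = (\<Union>i\<in>I. B' i)" using UA by simp
  have "disjoint_family_on B' I"
    using insert.prems(5) inj by (auto simp: disjoint_family_on_def B'_def image_Int[symmetric])
  moreover have "measure \<mu> (A i) = measure \<mu> (B' i)" if "i \<in> I" for i
    unfolding B'_def using insert.prems(2,3) that measure_full_group_image[OF pD(1), of "B i"]
    by (simp add: clopen_borel)
  moreover have "clopen (B' i)" if "i \<in> I" for i
    unfolding B'_def using insert.prems(2) that full_group_clopen_image[OF pD(1)] by simp
  moreover have "disjoint_family_on A I"
    using insert.prems(4) by (auto simp: disjoint_family_on_def)
  ultimately have "\<exists>h\<in>full_group \<phi>. finite_order h \<and> (\<forall>i\<in>I. h ` A i = B' i) \<and>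
      (\<forall>z. z \<notin> (\<Union>i\<in>I. A i) \<longrightarrow> h z = z)"
    using insert.IH[of B'] insert.prems(1) UB' by blast
  then obtain h where h: "h \<in> full_group \<phi>" "finite_order h" "\<And>i. i \<in> I \<Longrightarrow> h ` A i = B' i"
    "\<And>z. z \<notin> U - A n \<Longrightarrow> h z = z"
    unfolding UA by blast
  show ?case
  proof (intro bexI[of _ "p \<circ> h"] conjI ballI allI impI)
    show "p \<circ> h \<in> full_group \<phi>" using pD(1) h(1) by (rule full_group_comp)
    show "finite_order (p \<circ> h)"
      by (rule finite_order_comp_exchange[where C = "A n" and Q = "A n - B n" and P = "B n - A n"])
         (use h full_group_bij[OF h(1)] pD in auto)
    show "(p \<circ> h) ` A i = B i" if "i \<in> insert n I" for i
    proof (cases "i = n")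
      case True
      have "h ` A n = A n" using h(4) by force
      then show ?thesis using True pA by (simp only: image_comp[symmetric])
    next
      case False
      then have "h ` A i = p ` B i" using that h(3)[of i] by (simp add: B'_def)
      then show ?thesis using pp by (simp only: image_comp[symmetric])
    qed
    show "(p \<circ> h) z = z" if "z \<notin> (\<Union>i\<in>insert n I. A i)" for z
    proof -
      have "z \<notin> U" using that by (simp add: U_def)
      then show ?thesis using h(4)[of z] pD(6)[of z] AU BU by auto
    qed
  qed
qed

text \<open>The atoms \<open>A S\<close> sort points by which members of \<open>\<U>\<close> contain
  them; some may be empty. Each member is a union of atoms, so matching every atom with its image
  under \<open>g\<close> suffices.\<close>

lemma finite_order_approximation:
  assumes g: "g \<in> full_group \<phi>" and "finite \<U>" "\<And>U. U \<in> \<U> \<Longrightarrow> clopen U"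
  obtains h where "h \<in> full_group \<phi>" "finite_order h" "\<And>U. U \<in> \<U> \<Longrightarrow> h ` U = g ` U"
proof -
  define A where "A S = {x. {U \<in> \<U>. x \<in> U} = S}" for S
  have gb: "bij g" by (rule full_group_bij[OF g])
  have cA: "clopen (A S)" if "S \<in> Pow \<U>" for S
  proof -
    have "A S = (\<Inter>U\<in>\<U>. if U \<in> S then U else - U)" using that by (auto simp: A_def split: if_splits)
    moreover have "clopen \<dots>" using assms(2,3) by (intro clopen_INT) (simp_all add: clopen_Compl)
    ultimately show ?thesis by simp
  qed
  have dA: "disjoint_family_on A (Pow \<U>)" by (auto simp: disjoint_family_on_def A_def)
  have "x \<in> (\<Union>S\<in>Pow \<U>. A S)" for x
    by (rule UN_I[of "{U \<in> \<U>. x \<in> U}"]) (auto simp: A_def)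
  then have UA: "(\<Union>S\<in>Pow \<U>. A S) = UNIV" by (rule UNIV_eq_I[symmetric])
  have "disjoint_family_on (\<lambda>S. g ` A S) (Pow \<U>)"
    using dA gb by (auto simp: disjoint_family_on_def bij_def image_Int[symmetric])
  moreover have "(\<Union>S\<in>Pow \<U>. A S) = (\<Union>S\<in>Pow \<U>. g ` A S)"
    using UA gb by (simp add: image_UN[symmetric] bij_def)
  ultimately obtain h where h: "h \<in> full_group \<phi>" "finite_order h" "\<And>S. S \<in> Pow \<U> \<Longrightarrow> h ` A S = g ` A S"
    using finite_order_match[of "Pow \<U>" A "\<lambda>S. g ` A S"] assms(2) cA dA full_group_clopen_image[OF g]
      measure_full_group_image[OF g clopen_borel[OF cA]] by (metis finite_Pow_iff)
  show ?thesis
  proof (rule that[OF h(1,2)])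
    fix U assume "U \<in> \<U>"
    have "U = (\<Union>S\<in>{S \<in> Pow \<U>. U \<in> S}. A S)"
    proof (intro set_eqI iffI)
      fix x assume "x \<in> U"
      then show "x \<in> (\<Union>S\<in>{S \<in> Pow \<U>. U \<in> S}. A S)"
        using \<open>U \<in> \<U>\<close> by (intro UN_I[of "{V \<in> \<U>. x \<in> V}"]) (simp_all add: A_def)
    next
      fix x assume "x \<in> (\<Union>S\<in>{S \<in> Pow \<U>. U \<in> S}. A S)"
      then obtain S where "U \<in> S" "x \<in> A S" by blast
      then show "x \<in> U" unfolding A_def by blast
    qed
    then have "f ` U = (\<Union>S\<in>{S \<in> Pow \<U>. U \<in> S}. f ` A S)" for f :: "'a \<Rightarrow> 'a"
      by (metis image_UN)
    then show "h ` U = g ` U" using h(3) by simp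
  qed
qed

end

section \<open>Basic neighbourhoods of a homeomorphism, and density\<close>

lemma topspace_Homeo_topology: "topspace Homeo_topology = Homeo"
proof -
  have "g \<in> \<Union>{{g \<in> Homeo. g ` U = V} | U V. clopen U \<and> clopen V}" if "g \<in> Homeo" for g :: "'a \<Rightarrow> 'a"
    using that clopen_empty by blast
  then show ?thesis by (auto simp: Homeo_topology_def)
qed

text \<open>A subbasic set containing \<open>g\<close> prescribes the image of one clopen
  \<open>U\<close>, necessarily its image under \<open>g\<close>. At intersections the finite
  families are united; at unions the family of one member containing \<open>g\<close> is
  kept.\<close>

lemma Homeo_topology_basic_nbhd:
  assumes "openin Homeo_topology T" "g \<in> T"
  obtains \<U> where "finite \<U>" "\<And>U. U \<in> \<U> \<Longrightarrow> clopen U"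
    "\<And>f. f \<in> Homeo \<Longrightarrow> (\<And>U. U \<in> \<U> \<Longrightarrow> f ` U = g ` U) \<Longrightarrow> f \<in> T"
proof -
  have "generate_topology_on {{g \<in> Homeo. g ` U = V} | U V. clopen U \<and> clopen V} T"
    using assms(1) by (simp add: Homeo_topology_def openin_topology_generated_by_iff)
  then have "\<exists>\<U>. finite \<U> \<and> (\<forall>U\<in>\<U>. clopen U) \<and> (\<forall>f\<in>Homeo. (\<forall>U\<in>\<U>. f ` U = g ` U) \<longrightarrow> f \<in> T)"
    using assms(2)
  proof (induction T rule: generate_topology_on.induct)
    case Empty
    then show ?case by simp
  next
    case (Int S T)
    then obtain \<U> \<V> where "finite \<U> \<and> (\<forall>U\<in>\<U>. clopen U) \<and> (\<forall>f\<in>Homeo. (\<forall>U\<in>\<U>. f ` U = g ` U) \<longrightarrow> f \<in> S)"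
      "finite \<V> \<and> (\<forall>U\<in>\<V>. clopen U) \<and> (\<forall>f\<in>Homeo. (\<forall>U\<in>\<V>. f ` U = g ` U) \<longrightarrow> f \<in> T)"
      by auto
    then show ?case by (intro exI[of _ "\<U> \<union> \<V>"]) auto
  next
    case (UN K)
    then obtain S where S: "S \<in> K" "g \<in> S" by auto
    obtain \<U> where "finite \<U>" "\<forall>U\<in>\<U>. clopen U" "\<forall>f\<in>Homeo. (\<forall>U\<in>\<U>. f ` U = g ` U) \<longrightarrow> f \<in> S"
      using UN.IH[OF S] by (elim exE conjE)
    then show ?case using S(1) by (intro exI[of _ \<U>] conjI ballI impI UnionI[OF S(1)]) simp_all
  next
    case (Basis S)
    then obtain U V where "S = {g \<in> Homeo. g ` U = V}" "clopen U" "clopen V" by auto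
    then show ?case using Basis by (intro exI[of _ "{U}"]) auto
  qed
  then obtain \<U> where "finite \<U>" "\<forall>U\<in>\<U>. clopen U" "\<forall>f\<in>Homeo. (\<forall>U\<in>\<U>. f ` U = g ` U) \<longrightarrow> f \<in> T"
    by (elim exE conjE)
  then show ?thesis by (intro that[of \<U>]) simp_all
qed

theorem theorem6p2:
  fixes \<phi> :: "'a::topological_space \<Rightarrow> 'a"
  assumes "cantor_space (euclidean :: 'a topology)"
    and "minimal_homeo \<phi>"
    and "uniquely_ergodic \<phi>"
  shows "subtopology Homeo_topology (full_group \<phi>) closure_of {g \<in> full_group \<phi>. finite_order g}
           = full_group \<phi>"
proof -
  obtain \<mu> where "invariant_prob \<phi> \<mu>" "\<And>\<nu>. invariant_prob \<phi> \<nu> \<Longrightarrow> \<nu> = \<mu>"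
    using assms(3) by (auto simp: uniquely_ergodic_def)
  then interpret uniquely_ergodic_cantor "TYPE('a)" \<phi> \<mu>
    using assms by unfold_locales
  have top: "topspace (subtopology Homeo_topology (full_group \<phi>)) = full_group \<phi>"
    by (auto simp: topspace_Homeo_topology full_group_def)
  have "g \<in> subtopology Homeo_topology (full_group \<phi>) closure_of {g \<in> full_group \<phi>. finite_order g}"
    if g: "g \<in> full_group \<phi>" for g
    unfolding in_closure_of top
  proof (intro conjI allI impI g)
    fix T assume "g \<in> T \<and> openin (subtopology Homeo_topology (full_group \<phi>)) T"
    then obtain T' where T': "openin Homeo_topology T'" "T = T' \<inter> full_group \<phi>" "g \<in> T'"
      by (auto simp: openin_subtopology)
    obtain \<U> where \<U>: "finite \<U>" "\<And>U. U \<in> \<U> \<Longrightarrow> clopen U"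
      "\<And>f. f \<in> Homeo \<Longrightarrow> (\<And>U. U \<in> \<U> \<Longrightarrow> f ` U = g ` U) \<Longrightarrow> f \<in> T'"
      using Homeo_topology_basic_nbhd[OF T'(1,3)] by metis
    obtain h where h: "h \<in> full_group \<phi>" "finite_order h" "\<And>U. U \<in> \<U> \<Longrightarrow> h ` U = g ` U"
      using finite_order_approximation[OF g \<U>(1,2)] by metis
    then have "h \<in> T'" by (intro \<U>(3)) (auto simp: full_group_def)
    then show "\<exists>h. h \<in> {g \<in> full_group \<phi>. finite_order g} \<and> h \<in> T" using h T'(2) by auto
  qed
  then show ?thesis
    using closure_of_subset_topspace[of "subtopology Homeo_topology (full_group \<phi>)"] unfolding top by blast
qed

end
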